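(* Let $N\in\{2,3\}$, $\lambda_1,\lambda_2,\mu_1,\mu_2>0$, $\beta\in\mathbb{R}$, and let $\mathbf{u}\in\mathbb{H}$. Then $\mathbf{u}$ is a non-trivial critical point of $\mathcal{J}$ if and only if $\mathbf{u}\in\mathcal{N}$ and $\mathbf{u}$ is a constrained critical point of $\mathcal{J}$ on $\mathcal{N}$.
   Context: All functions are real valued. $E=W^{2,2}(\mathbb{R}^N)$, with norms $\|u\|_j^2=\int_{\mathbb{R}^N}|\Delta u|^2\,dx+\lambda_j\int_{\mathbb{R}^N}u^2\,dx$, $j=1,2$. $H\subset E$ is the subspace of radially symmetric functions; $\mathbb{E}=E\times E$, $\mathbb{H}=H\times H$, with norm $\|\mathbf{u}\|^2=\|u_1\|_1^2+\|u_2\|_2^2$ for $\mathbf{u}=(u_1,u_2)$. Set $$F(\mathbf{u})=\tfrac14\int_{\mathbb{R}^N}(\mu_1u_1^4+\mu_2u_2^4)\,dx,\quad G(\mathbf{u})=\tfrac12\int_{\mathbb{R}^N}u_1^2u_2^2\,dx,\quad \mathcal{J}(\mathbf{u})=\tfrac12\|\mathbf{u}\|^2-F(\mathbf{u})-\beta G(\mathbf{u}).$$ $\mathcal{J}$ is a $C^1$ functional on $\mathbb{E}$; non-trivial means $\mathbf{u}\neq\mathbf{0}=(0,0)$. The Nehari manifold is $\mathcal{N}=\{\mathbf{u}\in\mathbb{H}\setminus\{\mathbf{0}\}:\Psi(\mathbf{u})=0\}$, where $\Psi(\mathbf{u})=(\mathcal{J}'(\mathbf{u})\mid\mathbf{u})=\|\mathbf{u}\|^2-4F(\mathbf{u})-4\beta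 G(\mathbf{u})$. A point $\mathbf{u}\in\mathcal{N}$ is a constrained critical point of $\mathcal{J}$ on $\mathcal{N}$ if there is $\omega\in\mathbb{R}$ with $\mathcal{J}'(\mathbf{u})=\omega\Psi'(\mathbf{u})$ (equivalently, the derivative of $\mathcal{J}$ vanishes on the tangent space to $\mathcal{N}$ at $\mathbf{u}$). *)

theory Defs
  imports "HOL-Analysis.Analysis" "HOL-Library.Function_Algebras"
begin

(* Elements of the function spaces below are Borel representatives real^'n => real of the usual
   classes modulo null sets; vector operations are pointwise, and "nonzero" means "not almost
   everywhere zero". *)

section \<open>Test functions and weak derivatives\<close>

definition partial :: "'n \<Rightarrow> (real^'n::finite \<Rightarrow> real) \<Rightarrow> real^'n \<Rightarrow> real" where
  "partial i f x = frechet_derivative f (at x) (axis i 1)"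

primrec C_k :: "nat \<Rightarrow> (real^'n::finite \<Rightarrow> real) \<Rightarrow> bool" where
  "C_k 0 f \<longleftrightarrow> continuous_on UNIV f"
| "C_k (Suc k) f \<longleftrightarrow> (\<forall>x. f differentiable (at x)) \<and> (\<forall>i. C_k k (partial i f))"

definition test_function :: "(real^'n::finite \<Rightarrow> real) \<Rightarrow> bool" where
  "test_function \<phi> \<longleftrightarrow> (\<forall>k. C_k k \<phi>) \<and> compact (closure {x. \<phi> x \<noteq> 0})"

definition L2 :: "(real^'n::finite \<Rightarrow> real) set" where
  "L2 = {u \<in> borel_measurable borel. integrable lborel (\<lambda>x. (u x)\<^sup>2)}"

definition weak_partial :: "'n \<Rightarrow> (real^'n::finite \<Rightarrow> real) \<Rightarrow> (real^'n \<Rightarrow> real) \<Rightarrow> bool" where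
  "weak_partial i u g \<longleftrightarrow>
     (\<forall>\<phi>. test_function \<phi> \<longrightarrow>
        (LINT x|lborel. u x * partial i \<phi> x) = - (LINT x|lborel. g x * \<phi> x))"

section \<open>The space E, its radial subspace H, and their squares\<close>

definition W22 :: "(real^'n::finite \<Rightarrow> real) set" where
  "W22 = {u \<in> L2. \<forall>i. \<exists>g\<in>L2. weak_partial i u g \<and> (\<forall>j. \<exists>h\<in>L2. weak_partial j g h)}"

definition W22_rad :: "(real^'n::finite \<Rightarrow> real) set" where
  "W22_rad = {u \<in> W22. \<exists>f. AE x in lborel. u x = f (norm x)}"

(* Weak partial derivatives are unique only up to null sets, so D picks a representative. *)
definition D :: "'n \<Rightarrow> (real^'n::finite \<Rightarrow> real) \<Rightarrow> real^'n \<Rightarrow> real" where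
  "D i u = (SOME g. g \<in> L2 \<and> weak_partial i u g)"

definition laplacian :: "(real^'n::finite \<Rightarrow> real) \<Rightarrow> real^'n \<Rightarrow> real" where
  "laplacian u x = (\<Sum>i\<in>UNIV. D i (D i u) x)"

definition normsq :: "real \<Rightarrow> (real^'n::finite \<Rightarrow> real) \<Rightarrow> real" where
  "normsq lam u = (LINT x|lborel. (laplacian u x)\<^sup>2) + lam * (LINT x|lborel. (u x)\<^sup>2)"

type_synonym 'n fpair = "(real^'n \<Rightarrow> real) \<times> (real^'n \<Rightarrow> real)"

definition EE :: "'n::finite fpair set" where "EE = W22 \<times> W22"

definition HH :: "'n::finite fpair set" where "HH = W22_rad \<times> W22_rad"

definition scale :: "real \<Rightarrow> 'n::finite fpair \<Rightarrow> 'n fpair" where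
  "scale c u = ((\<lambda>x. c * fst u x), (\<lambda>x. c * snd u x))"

definition nontrivial :: "'n::finite fpair \<Rightarrow> bool" where
  "nontrivial u \<longleftrightarrow> \<not> (AE x in lborel. fst u x = 0 \<and> snd u x = 0)"

definition pair_norm :: "real \<Rightarrow> real \<Rightarrow> 'n::finite fpair \<Rightarrow> real" where
  "pair_norm lam1 lam2 u = sqrt (normsq lam1 (fst u) + normsq lam2 (snd u))"

section \<open>The functionals\<close>

definition F :: "real \<Rightarrow> real \<Rightarrow> 'n::finite fpair \<Rightarrow> real" where
  "F mu1 mu2 u = 1/4 * (LINT x|lborel. mu1 * (fst u x)^4 + mu2 * (snd u x)^4)"

definition G :: "'n::finite fpair \<Rightarrow> real" where
  "G u = 1/2 * (LINT x|lborel. (fst u x)\<^sup>2 * (snd u x)\<^sup>2)"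

definition J :: "real \<Rightarrow> real \<Rightarrow> real \<Rightarrow> real \<Rightarrow> real \<Rightarrow> 'n::finite fpair \<Rightarrow> real" where
  "J lam1 lam2 mu1 mu2 \<beta> u = 1/2 * (pair_norm lam1 lam2 u)\<^sup>2 - F mu1 mu2 u - \<beta> * G u"

definition Psi :: "real \<Rightarrow> real \<Rightarrow> real \<Rightarrow> real \<Rightarrow> real \<Rightarrow> 'n::finite fpair \<Rightarrow> real" where
  "Psi lam1 lam2 mu1 mu2 \<beta> u = (pair_norm lam1 lam2 u)\<^sup>2 - 4 * F mu1 mu2 u - 4 * \<beta> * G u"

(* L is the Frechet derivative at u of the functional f on EE: a bounded linear functional on EE
   with f (u + h) = f u + L h + o(pair_norm h). Only the values of L on EE are relevant. *)
definition has_frechet ::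
  "real \<Rightarrow> real \<Rightarrow> ('n::finite fpair \<Rightarrow> real) \<Rightarrow> ('n fpair \<Rightarrow> real) \<Rightarrow> 'n fpair \<Rightarrow> bool" where
  "has_frechet lam1 lam2 f L u \<longleftrightarrow>
     (\<forall>h\<in>EE. \<forall>k\<in>EE. L (h + k) = L h + L k) \<and>
     (\<forall>c. \<forall>h\<in>EE. L (scale c h) = c * L h) \<and>
     (\<exists>C. \<forall>h\<in>EE. \<bar>L h\<bar> \<le> C * pair_norm lam1 lam2 h) \<and>
     (\<forall>\<epsilon>>0. \<exists>\<delta>>0. \<forall>h\<in>EE. pair_norm lam1 lam2 h < \<delta> \<longrightarrow>
        \<bar>f (u + h) - f u - L h\<bar> \<le> \<epsilon> * pair_norm lam1 lam2 h)"

definition critical_point ::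
  "real \<Rightarrow> real \<Rightarrow> real \<Rightarrow> real \<Rightarrow> real \<Rightarrow> 'n::finite fpair \<Rightarrow> bool" where
  "critical_point lam1 lam2 mu1 mu2 \<beta> u \<longleftrightarrow>
     u \<in> EE \<and> has_frechet lam1 lam2 (J lam1 lam2 mu1 mu2 \<beta>) (\<lambda>h. 0) u"

definition Nehari :: "real \<Rightarrow> real \<Rightarrow> real \<Rightarrow> real \<Rightarrow> real \<Rightarrow> 'n::finite fpair set" where
  "Nehari lam1 lam2 mu1 mu2 \<beta> = {u \<in> HH. nontrivial u \<and> Psi lam1 lam2 mu1 mu2 \<beta> u = 0}"

(* The Nehari manifold lies in HH, so its tangent vectors are radial: the multiplier identity
   J'(u) = \<omega> Psi'(u) is one of functionals on HH. *)
definition constrained_critical_point ::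
  "real \<Rightarrow> real \<Rightarrow> real \<Rightarrow> real \<Rightarrow> real \<Rightarrow> 'n::finite fpair \<Rightarrow> bool" where
  "constrained_critical_point lam1 lam2 mu1 mu2 \<beta> u \<longleftrightarrow>
     u \<in> Nehari lam1 lam2 mu1 mu2 \<beta> \<and>
     (\<exists>L M. has_frechet lam1 lam2 (J lam1 lam2 mu1 mu2 \<beta>) L u \<and>
            has_frechet lam1 lam2 (Psi lam1 lam2 mu1 mu2 \<beta>) M u \<and>
            (\<exists>\<omega>. \<forall>h\<in>HH. L h = \<omega> * M h))"

end

theory Submission
  imports Defs "HOL-Computational_Algebra.Polynomial"
begin

text \<open>
  Everything rests on \<open>\<Psi> = 4 J - \<parallel>\<cdot>\<parallel>\<^sup>2\<close>, the quartic part of \<open>J\<close> having been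
  eliminated. Differentiability of \<open>\<Psi>\<close> at a point where \<open>J\<close> is differentiable is then
  differentiability of a quadratic form (\<open>has_frechet_Psi\<close>).
  Along the ray \<open>t \<mapsto> (1 + t) u\<close> both functionals are explicit polynomials in \<open>t\<close>, which gives
  \<open>J'(u) u = \<Psi>(u)\<close> and \<open>\<Psi>'(u) u = 4 \<Psi>(u) - 2 \<parallel>u\<parallel>\<^sup>2\<close> (\<open>scaling_derivatives\<close>).

  If \<open>J'(u) = 0\<close>, the first identity puts \<open>u\<close> on the Nehari manifold, and the multiplier
  \<open>\<omega> = 0\<close> will do. Conversely, let \<open>J'(u) = \<omega> \<Psi>'(u)\<close> on radial pairs, with
  \<open>\<Psi>(u) = 0\<close>. Testing with \<open>u\<close> itself gives \<open>0 = -2 \<omega> \<parallel>u\<parallel>\<^sup>2\<close>, so \<open>\<omega> = 0\<close> and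
  \<open>J'(u)\<close> vanishes on radial pairs. It remains to see that it vanishes on all pairs, which is
  Palais' principle of symmetric criticality.

  Since \<open>J\<close> is invariant under orthogonal changes of variables and \<open>u\<close> is radial, \<open>J'(u)\<close> is an
  invariant bounded functional (\<open>frechet_J_rotate\<close>). If such a functional \<open>\<Lambda>\<close> were not zero, the
  affine space \<open>\<Lambda> = 1\<close> would contain a unique element \<open>v\<close> of least \<open>W22\<close>-norm; by uniqueness \<open>v\<close> is
  invariant, hence radial, and \<open>\<Lambda> v = 0\<close> contrary to \<open>\<Lambda> v = 1\<close> (\<open>symmetric_criticality\<close>). The
  norm that is minimized is the full one, with all
  derivatives up to order two. It dominates \<open>\<parallel>\<cdot>\<parallel>\<close>, it is invariant, and its completeness
  (\<open>W22_complete\<close>) follows from that of \<open>L\<^sup>2\<close> because weak derivatives are closed under \<open>L\<^sup>2\<close>-limits.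
  The norm \<open>\<parallel>\<cdot>\<parallel>\<close> itself controls the individual derivatives less directly, through the sum that
  is the Laplacian.

  Three facts support this: an \<open>L\<^sup>2\<close>-function orthogonal to all test functions vanishes, so that
  weak derivatives are unique; Lebesgue measure is invariant under orthogonal maps; and a function
  that for each orthogonal map is invariant almost everywhere is almost everywhere a function of
  the norm (\<open>radial_if_invariant\<close>).
\<close>

section \<open>Lebesgue measure and orthogonal maps\<close>

lemma nn_integral_lborel_shift:
  fixes f :: "'a::euclidean_space \<Rightarrow> ennreal"
  assumes [measurable]: "f \<in> borel_measurable borel"
  shows "(\<integral>\<^sup>+x. f (c + x) \<partial>lborel) = (\<integral>\<^sup>+x. f x \<partial>lborel)"
  by (subst (2) lborel_distr_plus[of c, symmetric]) (simp add: nn_integral_distr)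

lemma nn_integral_lborel_reflect:
  fixes f :: "'a::euclidean_space \<Rightarrow> ennreal"
  assumes [measurable]: "f \<in> borel_measurable borel"
  shows "(\<integral>\<^sup>+x. f (c - x) \<partial>lborel) = (\<integral>\<^sup>+x. f x \<partial>lborel)"
proof -
  have "lborel = distr lborel borel (\<lambda>x. c - x)"
    using lborel_affine[of "-1" c] by (simp add: density_1)
  then have "(\<integral>\<^sup>+x. f x \<partial>lborel) = (\<integral>\<^sup>+x. f x \<partial>distr lborel borel (\<lambda>x. c - x))"
    by simp
  then show ?thesis by (simp add: nn_integral_distr)
qed

lemma borel_measurable_orthogonal:
  fixes g :: "'a::euclidean_space \<Rightarrow> 'a"
  assumes "orthogonal_transformation g"
  shows "g \<in> borel_measurable borel"
  by (intro borel_measurable_continuous_onI linear_continuous_on)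
     (use assms in \<open>auto simp: linear_conv_bounded_linear orthogonal_transformation_def\<close>)

text \<open>Uniqueness of Haar measure for the translation group: with \<open>B\<close> the unit ball, integrate
  \<open>1\<^sub>A(x) 1\<^sub>B(x + y)\<close> over \<open>x\<close> with respect to \<open>M\<close> and over \<open>y\<close> with respect to Lebesgue measure.
  One order of integration gives \<open>M A\<close> times the volume of \<open>B\<close>; the other, after shifting \<open>x\<close> by
  \<open>-y\<close>, gives the volume of \<open>A\<close> times \<open>M B\<close>. Agreement on balls fixes the constant and makes
  \<open>M\<close> sigma-finite, as Fubini's theorem requires.\<close>

lemma translation_invariant_eq_lborel:
  fixes M :: "'a::euclidean_space measure"
  assumes sets: "sets M = sets borel"
    and inv: "\<And>c. distr M borel ((+) c) = M"
    and ball: "\<And>r. emeasure M (ball 0 r) = emeasure lborel (ball (0::'a) r)"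
  shows "M = lborel"
proof (rule measure_eqI)
  note sets[measurable_cong]
  interpret M: sigma_finite_measure M
  proof
    have "space M = UNIV" using sets_eq_imp_space_eq[OF sets] by simp
    moreover have "(\<Union>n. ball (0::'a) (real n)) = UNIV"
      using reals_Archimedean2 by auto
    moreover have "emeasure M (ball 0 (real n)) \<noteq> \<infinity>" for n
      using ball[of "real n"] emeasure_lborel_ball_finite[of "0::'a" "real n"] by auto
    moreover have "ball 0 r \<in> sets M" for r by (simp add: sets)
    ultimately show "\<exists>A. countable A \<and> A \<subseteq> sets M \<and> \<Union>A = space M \<and> (\<forall>a\<in>A. emeasure M a \<noteq> \<infinity>)"
      by (intro exI[of _ "range (\<lambda>n. ball 0 (real n))"]) auto
  qed
  interpret P: pair_sigma_finite lborel M ..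
  fix A assume A: "A \<in> sets M"
  define B where "B = ball (0::'a) 1"
  have [measurable]: "A \<in> sets borel" "B \<in> sets borel" using A sets by (auto simp: B_def)
  have "emeasure M A * emeasure lborel B
      = (\<integral>\<^sup>+x. indicator A x * (\<integral>\<^sup>+y. indicator B y \<partial>lborel) \<partial>M)"
    by (simp add: nn_integral_multc)
  also have "\<dots> = (\<integral>\<^sup>+x. (\<integral>\<^sup>+y. indicator A x * indicator B (x + y) \<partial>lborel) \<partial>M)"
    by (simp add: nn_integral_cmult nn_integral_lborel_shift[of "indicator B"])
  also have "\<dots> = (\<integral>\<^sup>+y. (\<integral>\<^sup>+x. indicator A x * indicator B (x + y) \<partial>M) \<partial>lborel)"
    by (rule P.Fubini') measurable
  also have "\<dots> = (\<integral>\<^sup>+y. (\<integral>\<^sup>+x. indicator A (x - y) * indicator B x \<partial>M) \<partial>lborel)"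
  proof (rule nn_integral_cong)
    fix y :: 'a
    have "(\<integral>\<^sup>+x. indicator A (x - y) * indicator B x \<partial>M)
        = (\<integral>\<^sup>+x. indicator A (x - y) * indicator B x \<partial>distr M borel ((+) y))"
      by (simp add: inv)
    also have "\<dots> = (\<integral>\<^sup>+x. indicator A (y + x - y) * indicator B (y + x) \<partial>M)"
      by (rule nn_integral_distr) measurable
    finally show "(\<integral>\<^sup>+x. indicator A x * indicator B (x + y) \<partial>M)
        = (\<integral>\<^sup>+x. indicator A (x - y) * indicator B x \<partial>M)"
      by (simp add: add.commute)
  qed
  also have "\<dots> = (\<integral>\<^sup>+x. (\<integral>\<^sup>+y. indicator A (x - y) * indicator B x \<partial>lborel) \<partial>M)"
    by (rule P.Fubini'[symmetric]) measurable
  also have "\<dots> = (\<integral>\<^sup>+x. emeasure lborel A * indicator B x \<partial>M)"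
    by (subst nn_integral_multc) (auto simp: nn_integral_lborel_reflect)
  also have "\<dots> = emeasure lborel A * emeasure M B"
    by (rule nn_integral_cmult_indicator) (simp add: B_def sets)
  also have "emeasure M B = emeasure lborel B"
    unfolding B_def by (rule ball)
  finally have eq: "emeasure lborel B * emeasure M A = emeasure lborel B * emeasure lborel A"
    by (simp add: mult.commute)
  have "emeasure lborel B < \<infinity>" unfolding B_def by (rule emeasure_lborel_ball_finite)
  moreover have "emeasure lborel B \<noteq> 0"
  proof
    assume "emeasure lborel B = 0"
    then have "B \<in> null_sets lborel" by (simp add: null_sets_def)
    then have "negligible B" by (simp add: negligible_iff_null_sets null_sets_completionI)
    then show False using open_not_negligible[of B] by (auto simp: B_def)
  qed
  ultimately show "emeasure M A = emeasure lborel A"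
    using eq by (subst (asm) ennreal_mult_cancel_left) auto
qed (use sets in simp)

text \<open>The image measure is translation invariant because \<open>g\<close> is linear and onto, and it agrees with
  Lebesgue measure on balls about the origin because these are mapped onto themselves.\<close>

lemma distr_lborel_orthogonal:
  fixes g :: "'a::euclidean_space \<Rightarrow> 'a"
  assumes g: "orthogonal_transformation g"
  shows "distr lborel borel g = lborel"
proof (rule translation_invariant_eq_lborel)
  note [measurable] = borel_measurable_orthogonal[OF g]
  show "distr (distr lborel borel g) borel ((+) c) = distr lborel borel g" for c
  proof -
    have "g (inv g c + x) = c + g x" for x
      using g by (simp add: orthogonal_transformation_linear linear_add surj_f_inv_f
          orthogonal_transformation_surj)
    then have "(+) c \<circ> g = g \<circ> (+) (inv g c)" by auto
    then have "distr (distr lborel borel g) borel ((+) c)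
        = distr (distr lborel borel ((+) (inv g c))) borel g"
      by (simp add: distr_distr)
    then show ?thesis by (simp add: lborel_distr_plus)
  qed
  show "emeasure (distr lborel borel g) (ball 0 r) = emeasure lborel (ball (0::'a) r)" for r
  proof -
    have "g -` ball 0 r = ball 0 r" using g by (auto simp: orthogonal_transformation_norm)
    then show ?thesis by (simp add: emeasure_distr)
  qed
qed simp

lemma AE_lborel_orthogonal:
  fixes g :: "'a::euclidean_space \<Rightarrow> 'a"
  assumes g: "orthogonal_transformation g" and ae: "AE x in lborel. P x"
  shows "AE x in lborel. P (g x)"
proof -
  note [measurable] = borel_measurable_orthogonal[OF g]
  obtain N where N: "N \<in> null_sets lborel" "{x. \<not> P x} \<subseteq> N"
    using ae by (auto simp: eventually_ae_filter)
  have [measurable]: "N \<in> sets borel" using N by auto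
  have "AE x in distr lborel borel g. x \<notin> N"
    using AE_not_in[OF N(1)] by (subst distr_lborel_orthogonal[OF g])
  then have "AE x in lborel. g x \<notin> N"
    by (subst (asm) AE_distr_iff) auto
  then show ?thesis by eventually_elim (use N in auto)
qed

lemma
  fixes f :: "'a::euclidean_space \<Rightarrow> real" and g :: "'a \<Rightarrow> 'a"
  assumes g: "orthogonal_transformation g" and [measurable]: "f \<in> borel_measurable borel"
  shows integral_lborel_orthogonal: "(LINT x|lborel. f (g x)) = (LINT x|lborel. f x)"
    and integrable_lborel_orthogonal: "integrable lborel (\<lambda>x. f (g x)) \<longleftrightarrow> integrable lborel f"
proof -
  note [measurable] = borel_measurable_orthogonal[OF g]
  show "(LINT x|lborel. f (g x)) = (LINT x|lborel. f x)"
    by (subst (2) distr_lborel_orthogonal[OF g, symmetric]) (simp add: integral_distr)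
  show "integrable lborel (\<lambda>x. f (g x)) \<longleftrightarrow> integrable lborel f"
    by (subst (2) distr_lborel_orthogonal[OF g, symmetric]) (simp add: integrable_distr_eq)
qed

section \<open>Functions invariant under reflections are radial\<close>

definition householder :: "'a::real_inner \<Rightarrow> 'a \<Rightarrow> 'a" where
  "householder w x = x - (2 * (w \<bullet> x) / (w \<bullet> w)) *\<^sub>R w"

lemma orthogonal_householder: "orthogonal_transformation (householder w)"
  unfolding orthogonal_transformation
proof (intro conjI allI)
  show "linear (householder w)"
    by (rule linearI) (auto simp: householder_def algebra_simps add_divide_distrib)
  fix x
  have "householder w x \<bullet> householder w x = x \<bullet> x"
  proof (cases "w = 0")
    case False
    define c where "c = 2 * (w \<bullet> x) / (w \<bullet> w)"
    have "c * (w \<bullet> w) = 2 * (w \<bullet> x)" using False by (simp add: c_def)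
    then have "c * (c * (w \<bullet> w)) = c * (2 * (w \<bullet> x))" by simp
    moreover have "(x - c *\<^sub>R w) \<bullet> (x - c *\<^sub>R w)
        = x \<bullet> x - c * (2 * (w \<bullet> x)) + c * (c * (w \<bullet> w))"
      by (simp add: inner_diff_left inner_diff_right inner_commute[of x w] algebra_simps)
    ultimately show ?thesis by (simp add: householder_def c_def)
  qed (simp add: householder_def)
  then show "norm (householder w x) = norm x" by (simp add: norm_eq_sqrt_inner)
qed

lemma householder_swap:
  assumes "norm x = norm y" and "c \<noteq> 0"
  shows "householder (c *\<^sub>R (x - y)) x = y"
proof (cases "x = y")
  case False
  have "x \<bullet> x = y \<bullet> y" using assms by (simp add: dot_square_norm)
  then have "(x - y) \<bullet> (x - y) = 2 * ((x - y) \<bullet> x)"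
    by (simp add: inner_diff inner_commute algebra_simps)
  moreover have "(x - y) \<bullet> (x - y) \<noteq> 0" using False by simp
  ultimately have "2 * ((c *\<^sub>R (x - y)) \<bullet> x) / ((c *\<^sub>R (x - y)) \<bullet> (c *\<^sub>R (x - y))) = 1 / c"
    unfolding inner_scaleR_left inner_scaleR_right using assms(2) by (simp add: divide_simps)
  then show ?thesis using assms(2) by (simp add: householder_def)
qed (simp add: householder_def)

text \<open>For a unit vector \<open>e\<close> the reflection that carries \<open>e\<close> to the direction of \<open>z\<close> has axis
  \<open>\<bar>z\<bar> e - z\<close>. Outside the ray through \<open>e\<close> this parametrization of axes by \<open>z\<close> has the inverse
  \<open>w \<mapsto> (w \<bullet> w / (2 (w \<bullet> e))) e - w\<close>, which is differentiable and so maps null sets to null sets. The ray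
  itself is null in dimension at least two.\<close>

lemma null_preimage_chord_map:
  fixes e :: "'a::euclidean_space"
  assumes N: "N \<in> null_sets lborel" and e: "norm e = 1" and dim: "DIM('a) \<ge> 2"
  shows "AE z in lborel. norm z *\<^sub>R e - z \<notin> N"
proof -
  define f where "f w = ((w \<bullet> w) / (2 * (w \<bullet> e))) *\<^sub>R e - w" for w
  define N' where "N' = N \<inter> {w. w \<bullet> e \<noteq> 0}"
  have "negligible N"
    using N by (simp add: negligible_iff_null_sets null_sets_completionI)
  then have "negligible N'"
    by (rule negligible_subset) (simp add: N'_def)
  moreover have "f differentiable_on N'"
    unfolding differentiable_on_def
  proof
    fix w assume "w \<in> N'"
    then have "2 * (w \<bullet> e) \<noteq> 0" by (simp add: N'_def)
    then show "f differentiable at w within N'"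
      unfolding f_def by (intro derivative_intros differentiable_divide) auto
  qed
  ultimately have neg: "negligible (f ` N')"
    by (rule negligible_differentiable_image_negligible[OF order_refl])
  have "dim {e} < DIM('a)" using dim dim_le_card'[of "{e}"] by simp
  then have "negligible (span {e})"
    by (intro negligible_lowdim) simp
  with neg have "negligible (f ` N' \<union> span {e})" by simp
  moreover have "z \<in> f ` N' \<union> span {e}" if z: "norm z *\<^sub>R e - z \<in> N" for z
  proof (cases "e \<bullet> z = norm z")
    case True
    then have "e \<bullet> z = norm e * norm z" using e by simp
    then have "z = norm z *\<^sub>R e"
      using e by (subst (asm) norm_cauchy_schwarz_eq) simp
    then have "z \<in> span {e}" by (metis span_base span_scale singletonI)
    then show ?thesis by simp
  next
    case False
    define w where "w = norm z *\<^sub>R e - z"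
    have ee: "e \<bullet> e = 1" "z \<bullet> z = norm z * norm z"
      using e by (simp_all add: dot_square_norm power2_eq_square)
    have we: "w \<bullet> e = norm z - e \<bullet> z"
      by (simp add: w_def inner_diff_left ee inner_commute[of z e])
    moreover have "w \<bullet> w = 2 * norm z * (norm z - e \<bullet> z)"
      by (simp add: w_def inner_diff_left inner_diff_right ee inner_commute[of z e] algebra_simps)
    ultimately have "w \<bullet> w = norm z * (2 * (w \<bullet> e))" "w \<bullet> e \<noteq> 0"
      using False by simp_all
    then have "(w \<bullet> w) / (2 * (w \<bullet> e)) = norm z" by simp
    then have "f w = z" by (simp add: f_def w_def)
    moreover have "w \<in> N'" using z False we by (simp add: N'_def w_def)
    ultimately show ?thesis by blast
  qed
  ultimately have "AE z in lebesgue. norm z *\<^sub>R e - z \<notin> N"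
    unfolding eventually_ae_filter_negligible by blast
  then show ?thesis by (simp add: AE_completion_iff)
qed

text \<open>Invariance holds off a null set that depends on the map, and the maps are uncountably many. By
  Fubini's theorem, however, almost every \<open>x\<close> satisfies \<open>v (R\<^sub>w x) = v x\<close> for almost all
  axes \<open>w\<close> of reflections \<open>R\<^sub>w\<close>. For such an \<open>x\<close>, the chord map turns almost all axes into almost
  all directions, so that the rescaling of \<open>v\<close> to the sphere through \<open>x\<close> equals \<open>v x\<close> almost
  everywhere. The value \<open>v x\<close> is thereby determined by \<open>\<bar>x\<bar>\<close> alone.\<close>

lemma radial_if_invariant:
  fixes v :: "'a::euclidean_space \<Rightarrow> real"
  assumes [measurable]: "v \<in> borel_measurable borel" and dim: "DIM('a) \<ge> 2"
    and inv: "\<And>g. orthogonal_transformation g \<Longrightarrow> AE x in lborel. v (g x) = v x"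
  shows "\<exists>f. AE x in lborel. v x = f (norm x)"
proof -
  have meas [measurable]: "(\<lambda>p. householder (fst p) (snd p :: 'a)) \<in> borel_measurable (lborel \<Otimes>\<^sub>M lborel)"
    unfolding householder_def by measurable
  have "AE w in lborel. AE x in lborel. v (householder w x) = v x"
    by (intro AE_I2 inv orthogonal_householder)
  then have "AE x in lborel. AE w in lborel. v (householder w x) = v x"
    by (subst (asm) lborel_pair.AE_commute) measurable
  then have sphere: "AE x in lborel. AE z in lborel. v ((norm x / norm z) *\<^sub>R z) = v x"
  proof eventually_elim
    fix x :: 'a
    assume ae: "AE w in lborel. v (householder w x) = v x"
    show "AE z in lborel. v ((norm x / norm z) *\<^sub>R z) = v x"
    proof (cases "x = 0")
      case False
      define e where "e = x /\<^sub>R norm x"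
      have e: "norm e = 1" "x = norm x *\<^sub>R e" using False by (simp_all add: e_def)
      obtain N where N: "N \<in> null_sets lborel" "{w. v (householder w x) \<noteq> v x} \<subseteq> N"
        using ae by (auto simp: eventually_ae_filter)
      have "AE z in lborel. norm z *\<^sub>R e - z \<notin> N"
        by (rule null_preimage_chord_map) (use N e dim in auto)
      moreover have "AE z in lborel. z \<noteq> (0::'a)" by (rule AE_lborel_singleton)
      ultimately show ?thesis
      proof eventually_elim
        fix z assume z: "norm z *\<^sub>R e - z \<notin> N" "z \<noteq> 0"
        define y where "y = (norm x / norm z) *\<^sub>R z"
        have eq: "norm x = norm y" using z by (simp add: y_def)
        have "norm z *\<^sub>R e - z = (norm z / norm x) *\<^sub>R (x - y)"
          using z False by (simp add: e_def y_def scaleR_diff_right divide_simps)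
        then have "householder (norm z *\<^sub>R e - z) x = y"
          using householder_swap[OF eq, of "norm z / norm x"] z False by simp
        moreover have "v (householder (norm z *\<^sub>R e - z) x) = v x" using z N by blast
        ultimately show "v ((norm x / norm z) *\<^sub>R z) = v x" by (simp add: y_def)
      qed
    qed simp
  qed
  \<comment> \<open>Two such constants agree, the whole space not being null, so the choice is forced.\<close>
  define f where "f r = (SOME c. AE z in lborel. v ((r / norm (z::'a)) *\<^sub>R z) = c)" for r
  from sphere have "AE x in lborel. v x = f (norm x)"
  proof eventually_elim
    fix x :: 'a
    assume ae: "AE z in lborel. v ((norm x / norm z) *\<^sub>R z) = v x"
    then have "AE z in lborel. v ((norm x / norm (z::'a)) *\<^sub>R z) = f (norm x)"
      unfolding f_def by (rule someI)
    with ae have "AE z in (lborel :: 'a measure). v x = f (norm x)"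
      by eventually_elim simp
    then show "v x = f (norm x)" by (simp add: eventually_const_iff ae_filter_eq_bot_iff)
  qed
  then show ?thesis by blast
qed

section \<open>The Hilbert space of square-integrable functions\<close>

text \<open>Stated for coefficients, since it yields the Cauchy-Schwarz inequality both in \<open>L\<^sup>2\<close> and for the
  energy form on pairs.\<close>

lemma quadratic_nonneg_discriminant:
  fixes A B C :: real
  assumes q: "\<And>t. 0 \<le> A + 2 * t * B + t\<^sup>2 * C" and "0 \<le> C"
  shows "B\<^sup>2 \<le> A * C"
proof (cases "C = 0")
  case True
  have "B = 0"
  proof (rule ccontr)
    assume "B \<noteq> 0"
    then show False using q[of "- (A + 1) / (2 * B)"] True by (simp add: field_simps)
  qed
  then show ?thesis using True by simp
next
  case False
  then have "C > 0" using assms by simp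
  have "0 \<le> C * (A + 2 * (- B / C) * B + (- B / C)\<^sup>2 * C)"
    using q[of "- B / C"] \<open>C > 0\<close> by (intro mult_nonneg_nonneg) auto
  also have "\<dots> = A * C - B\<^sup>2"
    using False by (simp add: power2_eq_square field_simps)
  finally show ?thesis by simp
qed

lemma
  assumes "u \<in> L2"
  shows L2_measurable: "u \<in> borel_measurable borel"
    and L2_integrable_square: "integrable lborel (\<lambda>x. (u x)\<^sup>2)"
  using assms by (auto simp: L2_def)

lemma L2_integrable_mult:
  assumes "u \<in> L2" "v \<in> L2"
  shows "integrable lborel (\<lambda>x. u x * v x)"
proof (rule Bochner_Integration.integrable_bound)
  note [measurable] = L2_measurable[OF assms(1)] L2_measurable[OF assms(2)]
  show "integrable lborel (\<lambda>x. (u x)\<^sup>2 + (v x)\<^sup>2)"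
    using assms by (simp add: L2_integrable_square)
  show "(\<lambda>x. u x * v x) \<in> borel_measurable lborel" by measurable
  have "\<bar>a * b\<bar> \<le> a\<^sup>2 + b\<^sup>2" for a b :: real
  proof -
    have "2 * (\<bar>a\<bar> * \<bar>b\<bar>) \<le> a\<^sup>2 + b\<^sup>2"
      using sum_squares_bound[of "\<bar>a\<bar>" "\<bar>b\<bar>"] by (simp add: mult.assoc)
    moreover have "0 \<le> \<bar>a\<bar> * \<bar>b\<bar>" by simp
    ultimately show ?thesis unfolding abs_mult by linarith
  qed
  then show "AE x in lborel. norm (u x * v x) \<le> norm ((u x)\<^sup>2 + (v x)\<^sup>2)"
    by simp
qed

lemma L2_lincomb:
  assumes "u \<in> L2" "v \<in> L2"
  shows "(\<lambda>x. a * u x + b * v x) \<in> L2"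
proof -
  note [measurable] = L2_measurable[OF assms(1)] L2_measurable[OF assms(2)]
  have "(\<lambda>x. (a * u x + b * v x)\<^sup>2) = (\<lambda>x. a\<^sup>2 * (u x)\<^sup>2 + 2 * a * b * (u x * v x) + b\<^sup>2 * (v x)\<^sup>2)"
    by (simp add: fun_eq_iff power2_eq_square algebra_simps)
  moreover have "integrable lborel \<dots>"
    by (intro Bochner_Integration.integrable_add integrable_mult_right L2_integrable_mult
        L2_integrable_square assms)
  ultimately show ?thesis by (simp add: L2_def)
qed

lemma L2_add: "u \<in> L2 \<Longrightarrow> v \<in> L2 \<Longrightarrow> (\<lambda>x. u x + v x) \<in> L2"
  using L2_lincomb[of u v 1 1] by simp

lemma L2_diff: "u \<in> L2 \<Longrightarrow> v \<in> L2 \<Longrightarrow> (\<lambda>x. u x - v x) \<in> L2"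
  using L2_lincomb[of u v 1 "-1"] by simp

lemma L2_cmult: "u \<in> L2 \<Longrightarrow> (\<lambda>x. c * u x) \<in> L2"
  using L2_lincomb[of u u c 0] by simp

lemma L2_zero: "(\<lambda>x. 0) \<in> L2"
  by (simp add: L2_def)

lemma L2_sum: "(\<And>i. i \<in> I \<Longrightarrow> f i \<in> L2) \<Longrightarrow> (\<lambda>x. \<Sum>i\<in>I. f i x) \<in> L2"
  by (induction I rule: infinite_finite_induct) (auto simp: L2_zero L2_add)

lemma L2_orthogonal:
  fixes g :: "real^'n::finite \<Rightarrow> real^'n"
  assumes "orthogonal_transformation g" "u \<in> L2"
  shows "(\<lambda>x. u (g x)) \<in> L2"
proof -
  note [measurable] = L2_measurable[OF assms(2)] borel_measurable_orthogonal[OF assms(1)]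
  show ?thesis
    using integrable_lborel_orthogonal[OF assms(1), of "\<lambda>x. (u x)\<^sup>2"] L2_integrable_square[OF assms(2)]
    by (simp add: L2_def)
qed

lemma L2_indicator_box: "(\<lambda>x. indicator (box a b) x) \<in> L2"
proof -
  have "(\<lambda>x. (indicator (box a b) x :: real)\<^sup>2) = indicator (box a b)"
    by (auto simp: fun_eq_iff indicator_def)
  moreover have "integrable lborel (indicator (box a b) :: _ \<Rightarrow> real)"
    by (rule integrable_real_indicator) (auto simp: emeasure_lborel_box_finite[unfolded infinity_ennreal_def])
  ultimately show ?thesis by (simp add: L2_def)
qed

lemma L2_square_lincomb:
  assumes "u \<in> L2" "v \<in> L2"
  shows "(LINT x|lborel. (a * u x + b * v x)\<^sup>2) =
    a\<^sup>2 * (LINT x|lborel. (u x)\<^sup>2) + 2 * a * b * (LINT x|lborel. u x * v x)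
      + b\<^sup>2 * (LINT x|lborel. (v x)\<^sup>2)"
proof -
  have "(\<lambda>x. (a * u x + b * v x)\<^sup>2) = (\<lambda>x. a\<^sup>2 * (u x)\<^sup>2 + 2 * a * b * (u x * v x) + b\<^sup>2 * (v x)\<^sup>2)"
    by (simp add: fun_eq_iff power2_eq_square algebra_simps)
  moreover note L2_integrable_mult[OF assms] L2_integrable_square[OF assms(1)]
    L2_integrable_square[OF assms(2)]
  ultimately show ?thesis by simp
qed

lemma L2_Cauchy_Schwarz:
  assumes "u \<in> L2" "v \<in> L2"
  shows "(LINT x|lborel. u x * v x)\<^sup>2 \<le> (LINT x|lborel. (u x)\<^sup>2) * (LINT x|lborel. (v x)\<^sup>2)"
proof (rule quadratic_nonneg_discriminant)
  fix t :: real
  have "0 \<le> (LINT x|lborel. (1 * u x + t * v x)\<^sup>2)" by simp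
  then show "0 \<le> (LINT x|lborel. (u x)\<^sup>2) + 2 * t * (LINT x|lborel. u x * v x)
      + t\<^sup>2 * (LINT x|lborel. (v x)\<^sup>2)"
    by (subst (asm) L2_square_lincomb) (use assms in auto)
qed simp

text \<open>The Riesz-Fischer theorem. Along a subsequence whose increments \<open>d\<^sub>k\<close> have squared norm below
  \<open>(1/4)\<^sup>k\<close>, the series of \<open>2\<^sup>k d\<^sub>k\<^sup>2\<close> has finite integral, hence converges almost everywhere; as
  \<open>2 \<bar>d\<^sub>k\<bar> \<le> 2\<^sup>k d\<^sub>k\<^sup>2 + (1/2)\<^sup>k\<close>, the subsequence converges pointwise almost everywhere. Fatou's lemma
  turns this into convergence of the whole sequence in norm.\<close>

lemma L2_complete:
  fixes u :: "nat \<Rightarrow> real^'n::finite \<Rightarrow> real"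
  assumes u: "\<And>n. u n \<in> L2"
    and Cauchy: "\<And>e. e > 0 \<Longrightarrow> \<exists>N. \<forall>m\<ge>N. \<forall>n\<ge>N. (LINT x|lborel. (u m x - u n x)\<^sup>2) < e"
  shows "\<exists>v\<in>L2. (\<lambda>n. LINT x|lborel. (u n x - v x)\<^sup>2) \<longlonglongrightarrow> 0"
proof -
  note [measurable] = L2_measurable[OF u]
  have nn: "(\<integral>\<^sup>+x. ennreal ((u m x - u n x)\<^sup>2) \<partial>lborel) = ennreal (LINT x|lborel. (u m x - u n x)\<^sup>2)" for m n
    by (rule nn_integral_eq_integral) (auto intro!: L2_integrable_square L2_diff u)
  have "\<exists>r. \<forall>k. (\<forall>m\<ge>r k. \<forall>n\<ge>r k. (LINT x|lborel. (u m x - u n x)\<^sup>2) < (1/4) ^ k) \<and> r k < r (Suc k)"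
  proof (rule dependent_nat_choice)
    show "\<exists>N. \<forall>m\<ge>N. \<forall>n\<ge>N. (LINT x|lborel. (u m x - u n x)\<^sup>2) < (1/4) ^ 0"
      using Cauchy[of 1] by simp
    fix k y :: nat
    obtain N where "\<forall>m\<ge>N. \<forall>n\<ge>N. (LINT x|lborel. (u m x - u n x)\<^sup>2) < (1/4) ^ Suc k"
      using Cauchy[of "(1/4) ^ Suc k"] by auto
    then show "\<exists>z. (\<forall>m\<ge>z. \<forall>n\<ge>z. (LINT x|lborel. (u m x - u n x)\<^sup>2) < (1/4) ^ Suc k) \<and> y < z"
      by (intro exI[of _ "max N (Suc y)"]) auto
  qed
  then obtain r where r: "\<And>k m n. m \<ge> r k \<Longrightarrow> n \<ge> r k \<Longrightarrow> (LINT x|lborel. (u m x - u n x)\<^sup>2) < (1/4) ^ k"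
    and "\<And>k. r k < r (Suc k)" by blast
  then have mono: "strict_mono r" by (simp add: strict_mono_Suc_iff)
  define d where "d k x = u (r (Suc k)) x - u (r k) x" for k x
  have [measurable]: "d k \<in> borel_measurable borel" for k unfolding d_def by measurable
  have dk: "(\<integral>\<^sup>+x. ennreal (2 ^ k * (d k x)\<^sup>2) \<partial>lborel) \<le> ennreal ((1/2) ^ k)" for k
  proof -
    have "(\<integral>\<^sup>+x. ennreal (2 ^ k * (d k x)\<^sup>2) \<partial>lborel)
        = ennreal (2 ^ k) * ennreal (LINT x|lborel. (d k x)\<^sup>2)"
      using nn[of "r (Suc k)" "r k"] by (simp add: ennreal_mult nn_integral_cmult d_def)
    also have "\<dots> = ennreal (2 ^ k * (LINT x|lborel. (d k x)\<^sup>2))"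
      by (simp add: ennreal_mult)
    also have "\<dots> \<le> ennreal (2 ^ k * (1/4) ^ k)"
      using r[of k "r (Suc k)" "r k"] mono
      by (intro ennreal_leI mult_left_mono) (auto simp: d_def less_imp_le strict_mono_def)
    also have "2 ^ k * (1/4 :: real) ^ k = (1/2) ^ k"
      by (simp flip: power_mult_distrib)
    finally show ?thesis .
  qed
  have "(\<integral>\<^sup>+x. (\<Sum>k. ennreal (2 ^ k * (d k x)\<^sup>2)) \<partial>lborel)
      = (\<Sum>k. \<integral>\<^sup>+x. ennreal (2 ^ k * (d k x)\<^sup>2) \<partial>lborel)"
    by (rule nn_integral_suminf) measurable
  also have "\<dots> \<le> (\<Sum>k. ennreal ((1/2) ^ k))"
    by (intro suminf_le dk) auto
  also have "\<dots> < \<infinity>"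
    by (subst suminf_ennreal2) (auto simp: summable_geometric)
  finally have "AE x in lborel. (\<Sum>k. ennreal (2 ^ k * (d k x)\<^sup>2)) \<noteq> \<infinity>"
    by (intro nn_integral_PInf_AE) auto
  then have conv: "AE x in lborel. convergent (\<lambda>k. u (r k) x)"
  proof eventually_elim
    fix x assume "(\<Sum>k. ennreal (2 ^ k * (d k x)\<^sup>2)) \<noteq> \<infinity>"
    then have "summable (\<lambda>k. 2 ^ k * (d k x)\<^sup>2)"
      by (intro summable_suminf_not_top) auto
    moreover have "summable (\<lambda>k. (1/2 :: real) ^ k)" by (simp add: summable_geometric)
    ultimately have "summable (\<lambda>k. 2 ^ k * (d k x)\<^sup>2 + (1/2) ^ k)"
      by (rule summable_add)
    then have "summable (\<lambda>k. d k x)"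
    proof (rule summable_comparison_test')
      fix k :: nat
      have "2 * \<bar>d k x\<bar> \<le> 2 ^ k * (d k x)\<^sup>2 + (1/2) ^ k"
      proof -
        have "0 \<le> 2 ^ k * (\<bar>d k x\<bar> - (1/2) ^ k)\<^sup>2" by simp
        also have "\<dots> = 2 ^ k * (d k x)\<^sup>2 - 2 * (2 ^ k * (1/2) ^ k) * \<bar>d k x\<bar> + (2 ^ k * (1/2) ^ k) * (1/2) ^ k"
          by (simp add: power2_eq_square algebra_simps)
        also have "2 ^ k * (1/2 :: real) ^ k = 1" by (simp flip: power_mult_distrib)
        finally show ?thesis by simp
      qed
      then show "norm (d k x) \<le> 2 ^ k * (d k x)\<^sup>2 + (1/2) ^ k" by simp
    qed
    then have "convergent (\<lambda>n. \<Sum>k<n. d k x)" by (simp add: summable_iff_convergent)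
    moreover have "(\<Sum>k<n. d k x) = u (r n) x - u (r 0) x" for n
      unfolding d_def by (rule sum_lessThan_telescope)
    ultimately have "convergent (\<lambda>n. (u (r n) x - u (r 0) x) + u (r 0) x)"
      by (intro convergent_add convergent_const) simp
    then show "convergent (\<lambda>k. u (r k) x)" by simp
  qed
  define v where "v x = lim (\<lambda>k. u (r k) x)" for x
  have [measurable]: "v \<in> borel_measurable borel" unfolding v_def by measurable
  have fatou: "(\<integral>\<^sup>+x. ennreal ((u n x - v x)\<^sup>2) \<partial>lborel) \<le> ennreal ((1/4) ^ k)" if n: "n \<ge> r k" for n k
  proof -
    have "AE x in lborel. ennreal ((u n x - v x)\<^sup>2) = liminf (\<lambda>j. ennreal ((u n x - u (r j) x)\<^sup>2))"
      using conv
    proof eventually_elim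
      fix x assume "convergent (\<lambda>k. u (r k) x)"
      then have "(\<lambda>k. u (r k) x) \<longlonglongrightarrow> v x" by (simp add: v_def convergent_LIMSEQ_iff)
      then have "(\<lambda>j. ennreal ((u n x - u (r j) x)\<^sup>2)) \<longlonglongrightarrow> ennreal ((u n x - v x)\<^sup>2)"
        by (intro tendsto_ennrealI tendsto_intros)
      then show "ennreal ((u n x - v x)\<^sup>2) = liminf (\<lambda>j. ennreal ((u n x - u (r j) x)\<^sup>2))"
        by (intro lim_imp_Liminf[symmetric]) simp_all
    qed
    then have "(\<integral>\<^sup>+x. ennreal ((u n x - v x)\<^sup>2) \<partial>lborel)
        = (\<integral>\<^sup>+x. liminf (\<lambda>j. ennreal ((u n x - u (r j) x)\<^sup>2)) \<partial>lborel)"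
      by (rule nn_integral_cong_AE)
    also have "\<dots> \<le> liminf (\<lambda>j. \<integral>\<^sup>+x. ennreal ((u n x - u (r j) x)\<^sup>2) \<partial>lborel)"
      by (rule nn_integral_liminf) measurable
    also have "\<dots> \<le> liminf (\<lambda>j. ennreal ((1/4) ^ k))"
    proof (rule Liminf_mono)
      have "(\<integral>\<^sup>+x. ennreal ((u n x - u (r j) x)\<^sup>2) \<partial>lborel) \<le> ennreal ((1/4) ^ k)" if "j \<ge> k" for j
        unfolding nn using r[of k n "r j"] n that mono
        by (intro ennreal_leI) (auto simp: less_imp_le strict_mono_less_eq)
      then show "\<forall>\<^sub>F j in sequentially. (\<integral>\<^sup>+x. ennreal ((u n x - u (r j) x)\<^sup>2) \<partial>lborel) \<le> ennreal ((1/4) ^ k)"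
        by (rule eventually_sequentiallyI)
    qed
    also have "\<dots> = ennreal ((1/4) ^ k)" by (simp add: Liminf_const)
    finally show ?thesis .
  qed
  have "(\<lambda>x. u (r 0) x - v x) \<in> L2"
    using fatou[of 0 "r 0"] by (auto simp: L2_def integrable_iff_bounded intro: le_less_trans)
  then have v: "v \<in> L2" using L2_diff[OF u[of "r 0"]] by fastforce
  moreover have "(\<lambda>n. LINT x|lborel. (u n x - v x)\<^sup>2) \<longlonglongrightarrow> 0"
  proof (rule LIMSEQ_I)
    fix e :: real assume "e > 0"
    then obtain k where k: "(1/4 :: real) ^ k < e" using real_arch_pow_inv[of e "1/4"] by auto
    have "norm ((LINT x|lborel. (u n x - v x)\<^sup>2) - 0) < e" if "n \<ge> r k" for n
    proof -
      have "ennreal (LINT x|lborel. (u n x - v x)\<^sup>2) = (\<integral>\<^sup>+x. ennreal ((u n x - v x)\<^sup>2) \<partial>lborel)"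
        by (rule nn_integral_eq_integral[symmetric]) (auto intro!: L2_integrable_square L2_diff u v)
      with fatou[OF that] have "ennreal (LINT x|lborel. (u n x - v x)\<^sup>2) \<le> ennreal ((1/4) ^ k)"
        by (simp only:)
      then have "(LINT x|lborel. (u n x - v x)\<^sup>2) \<le> (1/4) ^ k"
        by (subst (asm) ennreal_le_iff) simp_all
      then show ?thesis using k by simp
    qed
    then show "\<exists>N. \<forall>n\<ge>N. norm ((LINT x|lborel. (u n x - v x)\<^sup>2) - 0) < e" by blast
  qed
  ultimately show ?thesis by blast
qed

section \<open>Test functions separate square-integrable functions\<close>

text \<open>With \<open>q = (x - a) (b - x)\<close>, the functions \<open>p / q\<^sup>m * exp (-c / q)\<close> on the interval, extended by zero,
  form a family closed under differentiation, so that smoothness needs only the first derivative.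
  The case \<open>p = 1\<close>, \<open>m = 0\<close> is the usual bump; the parameter \<open>c\<close> is there to tend to zero.\<close>

definition bump :: "real \<Rightarrow> real \<Rightarrow> real \<Rightarrow> real poly \<Rightarrow> nat \<Rightarrow> real \<Rightarrow> real" where
  "bump a b c p m x =
     (let q = (x - a) * (b - x) in if q > 0 then poly p x / q ^ m * exp (- c / q) else 0)"

text \<open>The numerator over \<open>q ^ (m + 2)\<close> that results from differentiating \<open>p / q\<^sup>m * exp (- c / q)\<close>.\<close>

definition bump_deriv :: "real \<Rightarrow> real \<Rightarrow> real \<Rightarrow> real poly \<Rightarrow> nat \<Rightarrow> real poly" where
  "bump_deriv a b c p m = (let q = [:-a, 1:] * [:b, -1:]
     in pderiv p * q\<^sup>2 - smult (real m) (p * pderiv q * q) + smult c (p * pderiv q))"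

lemma power_div_fact_le_exp:
  fixes x :: real
  assumes "x \<ge> 0"
  shows "x ^ k / fact k \<le> exp x"
proof -
  have "(\<Sum>n\<in>{k}. x ^ n /\<^sub>R fact n) \<le> (\<Sum>n. x ^ n /\<^sub>R fact n)"
    using assms by (intro sum_le_suminf sums_summable[OF exp_converges]) auto
  then show ?thesis using sums_unique[OF exp_converges, of x] by (simp add: divide_inverse mult.commute)
qed

text \<open>A bound of second order in \<open>q\<close> forces derivative zero at the endpoints. It comes from
  \<open>exp (c / q) \<ge> (c / q) ^ k / k!\<close> with \<open>k = m + 2\<close>: \<open>m\<close> powers cancel the pole and two are left.\<close>

lemma bump_quadratic_bound:
  assumes c: "c > 0"
  obtains K where "\<And>x. \<bar>bump a b c p m x\<bar> \<le> K * \<bar>poly p x\<bar> * ((x - a) * (b - x))\<^sup>2"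
proof
  fix x
  define q where "q = (x - a) * (b - x)"
  show "\<bar>bump a b c p m x\<bar> \<le> (fact (m + 2) / c ^ (m + 2)) * \<bar>poly p x\<bar> * ((x - a) * (b - x))\<^sup>2"
  proof (cases "q > 0")
    case True
    define X where "X = (c / q) ^ (m + 2)"
    have "X / fact (m + 2) \<le> exp (c / q)"
      unfolding X_def using c True by (intro power_div_fact_le_exp) auto
    moreover have "X > 0" unfolding X_def using c True by (intro zero_less_power) simp
    ultimately have "exp (- c / q) \<le> fact (m + 2) / X"
      by (simp add: exp_minus divide_simps mult.commute del: fact_Suc)
    then have "exp (- c / q) \<le> fact (m + 2) / (c / q) ^ (m + 2)"
      by (simp only: X_def)
    also have "\<dots> = fact (m + 2) / c ^ (m + 2) * q ^ (m + 2)"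
      by (simp add: power_divide)
    finally have "\<bar>poly p x\<bar> / q ^ m * exp (- c / q)
        \<le> \<bar>poly p x\<bar> / q ^ m * (fact (m + 2) / c ^ (m + 2) * q ^ (m + 2))"
      using True by (intro mult_left_mono) auto
    also have "\<dots> = fact (m + 2) / c ^ (m + 2) * \<bar>poly p x\<bar> * q\<^sup>2"
      using True by (simp add: power_add power2_eq_square)
    finally show ?thesis using True by (simp add: bump_def q_def[symmetric] Let_def abs_mult)
  next
    case False
    then show ?thesis using c by (simp add: bump_def q_def)
  qed
qed

lemma has_field_derivative_bump:
  assumes c: "c > 0"
  shows "(bump a b c p m has_field_derivative bump a b c (bump_deriv a b c p m) (m + 2) x) (at x)"
proof -
  define q where "q t = (t - a) * (b - t)" for t
  have dq: "(q has_field_derivative ((b - t) - (t - a))) (at t)" for t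
    unfolding q_def by (auto intro!: derivative_eq_intros)
  have cont: "continuous_on UNIV q" unfolding q_def by (intro continuous_intros)
  consider "q x > 0" | "q x < 0" | "q x = 0" by linarith
  then show ?thesis
  proof cases
    case 1
    let ?D = "b - x - (x - a)"
    have "((\<lambda>t. exp (- c / q t)) has_field_derivative exp (- c / q x) * (c * ?D / (q x)\<^sup>2)) (at x)"
      using 1 by (auto intro!: derivative_eq_intros dq[THEN DERIV_cong] simp: power2_eq_square)
    moreover have "((\<lambda>t. poly p t / q t ^ m) has_field_derivative
        (poly (pderiv p) x * q x - m * poly p x * ?D) / q x ^ (m + 1)) (at x)"
    proof -
      have "((\<lambda>t. poly p t / q t ^ m) has_field_derivative
        (poly (pderiv p) x * q x ^ m - poly p x * (m * (?D * q x ^ (m - Suc 0)))) / (q x ^ m * q x ^ m)) (at x)"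
        using 1 by (intro DERIV_divide poly_DERIV DERIV_power dq) simp
      moreover have "(poly (pderiv p) x * q x ^ m - poly p x * (m * (?D * q x ^ (m - Suc 0)))) / (q x ^ m * q x ^ m)
          = (poly (pderiv p) x * q x - m * poly p x * ?D) / q x ^ (m + 1)"
        using 1 by (cases m) (simp_all add: divide_simps, simp_all add: algebra_simps)
      ultimately show ?thesis by simp
    qed
    ultimately have "((\<lambda>t. poly p t / q t ^ m * exp (- c / q t)) has_field_derivative
        (poly (pderiv p) x * q x - m * poly p x * ?D) / q x ^ (m + 1) * exp (- c / q x)
          + exp (- c / q x) * (c * ?D / (q x)\<^sup>2) * (poly p x / q x ^ m)) (at x)"
      by (intro DERIV_mult)
    also have "(poly (pderiv p) x * q x - m * poly p x * ?D) / q x ^ (m + 1) * exp (- c / q x)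
          + exp (- c / q x) * (c * ?D / (q x)\<^sup>2) * (poly p x / q x ^ m)
        = (poly (pderiv p) x * (q x)\<^sup>2 - of_nat m * (poly p x * ?D * q x) + c * (poly p x * ?D)) / q x ^ (m + 2) * exp (- c / q x)"
      using 1 by (simp add: divide_simps power2_eq_square power_add) (simp add: algebra_simps)
    also have "\<dots> = bump a b c (bump_deriv a b c p m) (m + 2) x"
      using 1 by (simp add: bump_def bump_deriv_def q_def Let_def pderiv_pCons pderiv_mult algebra_simps)
    finally have "((\<lambda>t. poly p t / q t ^ m * exp (- c / q t)) has_field_derivative
        bump a b c (bump_deriv a b c p m) (m + 2) x) (at x)" .
    moreover have "\<forall>\<^sub>F t in nhds x. q t > 0"
      using 1 cont by (intro eventually_nhds_in_open[of "q -` {0<..}", THEN eventually_mono])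
        (auto intro!: open_vimage simp: continuous_on_eq_continuous_at)
    then have "\<forall>\<^sub>F t in nhds x. poly p t / q t ^ m * exp (- c / q t) = bump a b c p m t"
      by eventually_elim (simp add: bump_def q_def Let_def)
    ultimately show ?thesis by (subst (asm) DERIV_cong_ev) auto
  next
    case 2
    have "\<forall>\<^sub>F t in nhds x. q t < 0"
      using 2 cont by (intro eventually_nhds_in_open[of "q -` {..<0}", THEN eventually_mono])
        (auto intro!: open_vimage simp: continuous_on_eq_continuous_at)
    then have "\<forall>\<^sub>F t in nhds x. 0 = bump a b c p m t"
      by eventually_elim (simp add: bump_def q_def Let_def)
    moreover have "bump a b c (bump_deriv a b c p m) (m + 2) x = 0"
      using 2 by (simp add: bump_def q_def)
    moreover have "((\<lambda>t. 0) has_field_derivative 0) (at x)" by simp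
    ultimately show ?thesis by (subst (asm) DERIV_cong_ev[OF refl _ refl]) auto
  next
    case 3
    have zero: "bump a b c p' m' x = 0" for p' m'
      using 3 unfolding q_def bump_def Let_def by (simp only: less_irrefl if_False)
    obtain K where K: "\<And>t. \<bar>bump a b c p m t\<bar> \<le> K * \<bar>poly p t\<bar> * (q t)\<^sup>2"
      using bump_quadratic_bound[OF c] unfolding q_def by blast
    have "((\<lambda>t. (bump a b c p m t - bump a b c p m x) / (t - x)) \<longlongrightarrow> 0) (at x)"
    proof (rule Lim_null_comparison)
      show "\<forall>\<^sub>F t in at x. norm ((bump a b c p m t - bump a b c p m x) / (t - x))
          \<le> K * \<bar>poly p t\<bar> * \<bar>q t\<bar> * \<bar>(q t - q x) / (t - x)\<bar>"
      proof (rule always_eventually, rule allI)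
        fix t
        have "\<bar>bump a b c p m t\<bar> / \<bar>t - x\<bar> \<le> K * \<bar>poly p t\<bar> * (q t)\<^sup>2 / \<bar>t - x\<bar>"
          by (intro divide_right_mono K) simp
        then show "norm ((bump a b c p m t - bump a b c p m x) / (t - x))
          \<le> K * \<bar>poly p t\<bar> * \<bar>q t\<bar> * \<bar>(q t - q x) / (t - x)\<bar>"
          unfolding zero 3 power2_abs[of "q t", symmetric] power2_eq_square[of "\<bar>q t\<bar>"]
          by (simp add: abs_divide mult.assoc)
      qed
      have "((\<lambda>t. K * \<bar>poly p t\<bar> * \<bar>q t\<bar> * \<bar>(q t - q x) / (t - x)\<bar>) \<longlongrightarrow>
          K * \<bar>poly p x\<bar> * \<bar>q x\<bar> * \<bar>(b - x) - (x - a)\<bar>) (at x)"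
        using cont dq[of x]
        by (intro tendsto_intros) (auto simp: has_field_derivative_iff continuous_on_eq_continuous_at isCont_def)
      then show "((\<lambda>t. K * \<bar>poly p t\<bar> * \<bar>q t\<bar> * \<bar>(q t - q x) / (t - x)\<bar>) \<longlongrightarrow> 0) (at x)"
        by (simp add: 3)
    qed
    then show ?thesis by (simp add: has_field_derivative_iff zero)
  qed
qed

definition box_bump :: "real^'n::finite \<Rightarrow> real^'n \<Rightarrow> real \<Rightarrow> ('n \<Rightarrow> real poly) \<Rightarrow> ('n \<Rightarrow> nat) \<Rightarrow> real^'n \<Rightarrow> real"
  where "box_bump a b c p m x = (\<Prod>i\<in>UNIV. bump (a $ i) (b $ i) c (p i) (m i) (x $ i))"

text \<open>Since each factor depends on one coordinate, differentiating in direction \<open>i\<close> changes only the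
  parameters of factor \<open>i\<close>. Products of bumps are thus closed under partial derivatives, without
  any sums appearing.\<close>

lemma has_derivative_box_bump:
  assumes c: "c > 0"
  shows "(box_bump a b c p m has_derivative
     (\<lambda>h. \<Sum>i\<in>UNIV. h $ i * box_bump a b c (p(i := bump_deriv (a $ i) (b $ i) c (p i) (m i))) (m(i := m i + 2)) x))
     (at x)"
proof -
  have "((\<lambda>y. bump (a $ i) (b $ i) c (p i) (m i) (y $ i)) has_derivative
      (\<lambda>h. bump (a $ i) (b $ i) c (bump_deriv (a $ i) (b $ i) c (p i) (m i)) (m i + 2) (x $ i) * (h $ i))) (at x)" for i
    using has_field_derivative_bump[OF c, of "a $ i" "b $ i" "p i" "m i" "x $ i"]
    unfolding has_field_derivative_def
    by (rule has_derivative_compose[rotated]) (rule bounded_linear_imp_has_derivative[OF bounded_linear_vec_nth])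
  then have "(box_bump a b c p m has_derivative (\<lambda>h. \<Sum>i\<in>UNIV.
      bump (a $ i) (b $ i) c (bump_deriv (a $ i) (b $ i) c (p i) (m i)) (m i + 2) (x $ i) * (h $ i)
       * (\<Prod>j\<in>UNIV - {i}. bump (a $ j) (b $ j) c (p j) (m j) (x $ j)))) (at x)"
    unfolding box_bump_def[abs_def] by (rule has_derivative_prod)
  moreover have "bump (a $ i) (b $ i) c (bump_deriv (a $ i) (b $ i) c (p i) (m i)) (m i + 2) (x $ i) * (h $ i)
       * (\<Prod>j\<in>UNIV - {i}. bump (a $ j) (b $ j) c (p j) (m j) (x $ j))
     = h $ i * box_bump a b c (p(i := bump_deriv (a $ i) (b $ i) c (p i) (m i))) (m(i := m i + 2)) x" for i h
  proof -
    let ?b = "\<lambda>j. bump (a $ j) (b $ j) c ((p(i := bump_deriv (a $ i) (b $ i) c (p i) (m i))) j)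
        ((m(i := m i + 2)) j) (x $ j)"
    have "(\<Prod>j\<in>UNIV. ?b j) = ?b i * (\<Prod>j\<in>UNIV - {i}. ?b j)"
      by (rule prod.remove) auto
    also have "(\<Prod>j\<in>UNIV - {i}. ?b j) = (\<Prod>j\<in>UNIV - {i}. bump (a $ j) (b $ j) c (p j) (m j) (x $ j))"
      by (rule prod.cong) auto
    finally show ?thesis unfolding box_bump_def by simp
  qed
  ultimately show ?thesis by (simp only:)
qed

lemma partial_box_bump:
  assumes "c > 0"
  shows "partial i (box_bump a b c p m)
    = box_bump a b c (p(i := bump_deriv (a $ i) (b $ i) c (p i) (m i))) (m(i := m i + 2))"
proof
  fix x
  show "partial i (box_bump a b c p m) x
    = box_bump a b c (p(i := bump_deriv (a $ i) (b $ i) c (p i) (m i))) (m(i := m i + 2)) x"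
    unfolding partial_def frechet_derivative_at[OF has_derivative_box_bump[OF assms], symmetric]
    by (simp add: axis_def if_distrib[of "\<lambda>z. z * _"] sum.delta cong: if_cong)
qed

lemma box_bump_outside:
  assumes "x \<notin> box a b" and "\<And>i. a $ i \<le> b $ i"
  shows "box_bump a b c p m x = 0"
proof -
  obtain i where "\<not> (a $ i < x $ i \<and> x $ i < b $ i)"
    using assms by (auto simp: mem_box_cart)
  then have "\<not> (x $ i - a $ i) * (b $ i - x $ i) > 0"
    using assms(2)[of i] by (auto simp: zero_less_mult_iff)
  then have "bump (a $ i) (b $ i) c (p i) (m i) (x $ i) = 0" by (simp add: bump_def)
  then show ?thesis unfolding box_bump_def by (intro prod_zero) auto
qed

lemma test_function_box_bump:
  assumes c: "c > 0" and le: "\<And>i. a $ i \<le> b $ i"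
  shows "test_function (box_bump a b c p m)"
  unfolding test_function_def
proof (intro conjI allI)
  show "C_k k (box_bump a b c p m)" for k
  proof (induction k arbitrary: p m)
    case 0
    have "continuous (at x) (box_bump a b c p m)" for x
      by (rule has_derivative_continuous[OF has_derivative_box_bump[OF c]])
    then show ?case by (simp add: continuous_on_eq_continuous_at)
  next
    case (Suc k)
    have "box_bump a b c p m differentiable (at x)" for x
      by (rule differentiableI[OF has_derivative_box_bump[OF c]])
    moreover have "C_k k (partial i (box_bump a b c p m))" for i
      unfolding partial_box_bump[OF c] by (rule Suc.IH)
    ultimately show ?case by simp
  qed
  have "{x. box_bump a b c p m x \<noteq> 0} \<subseteq> box a b"
    using box_bump_outside[of _ a b c p m] le by blast
  then have "bounded {x. box_bump a b c p m x \<noteq> 0}"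
    by (rule bounded_subset[OF bounded_box])
  then show "compact (closure {x. box_bump a b c p m x \<noteq> 0})" by simp
qed

text \<open>As \<open>c\<close> tends to zero the bumps on a box converge boundedly to its indicator, so the integral of
  \<open>f\<close> over every box vanishes. Boxes are stable under intersection and generate the Borel sets,
  which extends this to Borel subsets of a bounded box by a Dynkin argument. The restriction to a
  bounded box makes \<open>f\<close> integrable.\<close>

lemma L2_eq_0_if_orthogonal_to_test_functions:
  fixes f :: "real^'n::finite \<Rightarrow> real"
  assumes f: "f \<in> L2"
    and orth: "\<And>\<phi>. test_function \<phi> \<Longrightarrow> (LINT x|lborel. f x * \<phi> x) = 0"
  shows "AE x in lborel. f x = 0"
proof -
  note [measurable] = L2_measurable[OF f]
  have int: "integrable lborel (\<lambda>x. f x * indicator (box a b) x)" for a b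
    by (rule L2_integrable_mult[OF f L2_indicator_box])
  have box: "(LINT x|lborel. f x * indicator (box a b) x) = 0" for a b
  proof (cases "\<forall>i. a $ i < b $ i")
    case True
    define \<phi> where "\<phi> n = box_bump a b (1 / real (Suc n)) (\<lambda>i. 1) (\<lambda>i. 0)" for n
    have test: "test_function (\<phi> n)" for n
      unfolding \<phi>_def using True by (intro test_function_box_bump) (auto simp: less_imp_le)
    then have [measurable]: "\<phi> n \<in> borel_measurable borel" for n
      by (intro borel_measurable_continuous_onI) (metis test_function_def C_k.simps(1))
    have bnd: "\<bar>\<phi> n x\<bar> \<le> indicator (box a b) x" for n x
    proof (cases "x \<in> box a b")
      case True
      have "\<bar>\<phi> n x\<bar> \<le> (\<Prod>i\<in>(UNIV::'n set). 1)"
        unfolding \<phi>_def box_bump_def abs_prod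
        by (intro prod_mono) (auto simp: bump_def Let_def)
      then show ?thesis using True by simp
    next
      case False
      then show ?thesis using \<open>\<forall>i. a $ i < b $ i\<close>
        by (auto simp: \<phi>_def box_bump_outside less_imp_le)
    qed
    have lim: "(\<lambda>n. \<phi> n x) \<longlonglongrightarrow> indicator (box a b) x" for x
    proof (cases "x \<in> box a b")
      case True
      then have q: "(x $ i - a $ i) * (b $ i - x $ i) > 0" for i by (auto simp: mem_box_cart)
      have "(\<lambda>n. \<Prod>i\<in>(UNIV::'n set). exp (- (1 / real (Suc n)) / ((x $ i - a $ i) * (b $ i - x $ i))))
          \<longlonglongrightarrow> (\<Prod>i\<in>(UNIV::'n set). exp (- 0 / ((x $ i - a $ i) * (b $ i - x $ i))))"
        using q by (intro tendsto_prod tendsto_exp tendsto_divide tendsto_minus tendsto_const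
            LIMSEQ_Suc lim_1_over_n) (metis less_irrefl)
      then show ?thesis using True q by (simp add: \<phi>_def box_bump_def bump_def)
    next
      case False
      then have "\<phi> n x = 0" for n using bnd[of n x] by simp
      then show ?thesis using False by simp
    qed
    have "(\<lambda>n. LINT x|lborel. f x * \<phi> n x) \<longlonglongrightarrow> (LINT x|lborel. f x * indicator (box a b) x)"
    proof (rule integral_dominated_convergence)
      show "integrable lborel (\<lambda>x. \<bar>f x * indicator (box a b) x\<bar>)" using int by simp
      show "AE x in lborel. (\<lambda>n. f x * \<phi> n x) \<longlonglongrightarrow> f x * indicator (box a b) x"
        by (intro AE_I2 tendsto_intros lim)
      have "norm (f x * \<phi> n x) \<le> \<bar>f x * indicator (box a b) x\<bar>" for n x
        using mult_left_mono[OF bnd[of n x], of "\<bar>f x\<bar>"] by (simp add: abs_mult)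
      then show "AE x in lborel. norm (f x * \<phi> n x) \<le> \<bar>f x * indicator (box a b) x\<bar>" for n
        by simp
    qed measurable
    then show ?thesis using orth[OF test] by (simp add: LIMSEQ_const_iff)
  next
    case False
    then have "box a b = {}" by (auto simp: interval_eq_empty_cart not_less)
    then show ?thesis by simp
  qed
  define B :: "nat \<Rightarrow> (real^'n) set" where "B n = box (- (real n *\<^sub>R One)) (real n *\<^sub>R One)" for n
  have "AE x in lborel. f x * indicator (B n) x = 0" for n
  proof (rule sigma_finite_measure.density_zero[OF sigma_finite_lborel])
    show intB: "integrable lborel (\<lambda>x. f x * indicator (B n) x)" unfolding B_def by (rule int)
    have bor: "sigma_sets UNIV (range (\<lambda>(a, b). box a b :: (real^'n) set)) = sets borel"
      by (simp add: borel_eq_box)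
    fix A :: "(real^'n) set" assume "A \<in> sets lborel"
    then have "A \<in> sigma_sets UNIV (range (\<lambda>(a, b). box a b))"
      by (simp add: bor)
    moreover have "Int_stable (range (\<lambda>(a, b). box a b :: (real^'n) set))"
      by (auto simp: Int_stable_def box_Int_box)
    moreover have "range (\<lambda>(a, b). box a b) \<subseteq> Pow (UNIV :: (real^'n) set)" by simp
    ultimately have "A \<in> sigma_sets UNIV (range (\<lambda>(a, b). box a b))"
      "Int_stable (range (\<lambda>(a, b). box a b :: (real^'n) set))"
      "range (\<lambda>(a, b). box a b) \<subseteq> Pow (UNIV :: (real^'n) set)" by simp_all
    from this(2,3,1) show "set_lebesgue_integral lborel A (\<lambda>x. f x * indicator (B n) x) = 0"
    proof (induction A rule: sigma_sets_induct_disjoint)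
      case (basic A)
      then obtain a b where "A = box a b" by auto
      moreover obtain a' b' where "box a b \<inter> B n = box a' b'"
        unfolding B_def box_Int_box by blast
      moreover have "indicator A x * (f x * indicator (B n) x) = f x * indicator (A \<inter> B n) x" for x
        by (simp add: indicator_inter_arith)
      ultimately have "indicator A x * (f x * indicator (B n) x) = f x * indicator (box a' b') x" for x
        by (simp only:)
      then show ?case by (simp only: set_lebesgue_integral_def real_scaleR_def box)
    next
      case (compl A)
      then have A: "A \<in> sets lborel" using bor by simp
      have "(\<integral>x\<in>UNIV - A. f x * indicator (B n) x \<partial>lborel)
        = (LINT x|lborel. f x * indicator (B n) x - indicator A x *\<^sub>R (f x * indicator (B n) x))"
        unfolding set_lebesgue_integral_def
        by (rule Bochner_Integration.integral_cong) (auto simp: indicator_def)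
      also have "\<dots> = (LINT x|lborel. f x * indicator (B n) x) - (\<integral>x\<in>A. f x * indicator (B n) x \<partial>lborel)"
        unfolding set_lebesgue_integral_def
        by (rule Bochner_Integration.integral_diff[OF intB integrable_mult_indicator[OF A intB]])
      finally show ?case using compl box by (simp add: B_def)
    next
      case (union A)
      then have A: "A i \<in> sets lborel" for i using bor by auto
      have "set_integrable lborel (\<Union>i. A i) (\<lambda>x. f x * indicator (B n) x)"
        unfolding set_integrable_def by (rule integrable_mult_indicator[OF _ intB]) (use A in auto)
      then have "(\<integral>x\<in>(\<Union>i. A i). f x * indicator (B n) x \<partial>lborel)
          = (\<Sum>i. \<integral>x\<in>A i. f x * indicator (B n) x \<partial>lborel)"
        using A union(1) by (intro lebesgue_integral_countable_add) (auto simp: disjoint_family_on_def)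
      then show ?case using union by simp
    qed (simp add: set_lebesgue_integral_def)
  qed
  then have "AE x in lborel. \<forall>n. f x * indicator (B n) x = 0" by (subst AE_all_countable) blast
  then show ?thesis
  proof eventually_elim
    fix x assume *: "\<forall>n. f x * indicator (B n) x = 0"
    have "x \<in> (\<Union>n. B n)" unfolding B_def UN_box_eq_UNIV by simp
    then obtain n where "x \<in> B n" by blast
    then show "f x = 0" using *[rule_format, of n] by simp
  qed
qed

section \<open>Test functions and weak derivatives under linear maps and limits\<close>

lemma C_k_lincomb:
  "C_k k f \<Longrightarrow> C_k k g \<Longrightarrow> C_k k (\<lambda>x. a * f x + b * g x)"
proof (induction k arbitrary: f g)
  case 0
  then show ?case by (auto intro!: continuous_intros)
next
  case (Suc k)
  have df: "f differentiable (at x)" and dg: "g differentiable (at x)" for x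
    using Suc.prems by auto
  have "partial i (\<lambda>x. a * f x + b * g x) = (\<lambda>x. a * partial i f x + b * partial i g x)" for i
  proof
    fix x
    have "((\<lambda>x. a * f x + b * g x) has_derivative
      (\<lambda>h. a * frechet_derivative f (at x) h + b * frechet_derivative g (at x) h)) (at x)"
      using df[of x, unfolded frechet_derivative_works] dg[of x, unfolded frechet_derivative_works]
      by (auto intro!: derivative_eq_intros)
    from frechet_derivative_at[OF this]
    show "partial i (\<lambda>x. a * f x + b * g x) x = a * partial i f x + b * partial i g x"
      unfolding partial_def by metis
  qed
  moreover have "C_k k (\<lambda>x. a * partial i f x + b * partial i g x)" for i
    using Suc by auto
  ultimately show ?case using df dg by (auto intro!: derivative_intros)
qed

lemma C_k_zero: "C_k k (\<lambda>x. 0)"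
proof (induction k)
  case (Suc k)
  have "partial i (\<lambda>x. 0) = (\<lambda>x. 0)" for i :: 'a
    by (simp add: partial_def fun_eq_iff)
  then show ?case using Suc by simp
qed simp

lemma C_k_sum: "(\<And>j. C_k k (f j)) \<Longrightarrow> C_k k (\<lambda>x. \<Sum>j\<in>I. c j * f j x)"
proof (induction I rule: infinite_finite_induct)
  case (insert j I)
  have "C_k k (\<lambda>x. c j * f j x + 1 * (\<Sum>j\<in>I. c j * f j x))"
    by (intro C_k_lincomb insert)
  then show ?case using insert by simp
qed (simp_all add: C_k_zero)

text \<open>The chain rule in coordinates: \<open>g (axis i 1) $ j\<close> is the \<open>(j, i)\<close> entry of the matrix of \<open>g\<close>.
  This convention for matrix entries is kept for gradients and Hessians.\<close>

lemma partial_compose_linear: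
  fixes f :: "real^'n::finite \<Rightarrow> real" and g :: "real^'n \<Rightarrow> real^'n"
  assumes g: "linear g" and f: "\<And>x. f differentiable (at x)"
  shows "partial i (\<lambda>x. f (g x)) x = (\<Sum>j\<in>UNIV. g (axis i 1) $ j * partial j f (g x))"
proof -
  define f' where "f' = frechet_derivative f (at (g x))"
  have f': "(f has_derivative f') (at (g x))"
    unfolding f'_def by (rule f[unfolded frechet_derivative_works])
  have "(g has_derivative g) (at x)"
    using g by (simp add: linear_imp_has_derivative)
  from has_derivative_compose[OF this f']
  have "frechet_derivative (\<lambda>x. f (g x)) (at x) = (\<lambda>h. f' (g h))"
    by (rule frechet_derivative_at[symmetric])
  then have "partial i (\<lambda>x. f (g x)) x = f' (g (axis i 1))"
    by (simp add: partial_def)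
  also have "g (axis i 1) = (\<Sum>j\<in>UNIV. g (axis i 1) $ j *\<^sub>R axis j 1)"
    unfolding scalar_mult_eq_scaleR[symmetric] by (rule basis_expansion[symmetric])
  also have "f' \<dots> = (\<Sum>j\<in>UNIV. g (axis i 1) $ j * f' (axis j 1))"
    by (simp only: linear_sum[OF has_derivative_linear[OF f']]
      linear_scale[OF has_derivative_linear[OF f']] real_scaleR_def)
  finally show ?thesis by (simp add: partial_def f'_def)
qed

lemma C_k_compose_linear:
  fixes f :: "real^'n::finite \<Rightarrow> real" and g :: "real^'n \<Rightarrow> real^'n"
  assumes g: "linear g"
  shows "C_k k f \<Longrightarrow> C_k k (\<lambda>x. f (g x))"
proof (induction k arbitrary: f)
  case 0
  have "continuous_on UNIV g" using g by (simp add: linear_continuous_on linear_conv_bounded_linear)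
  then show ?case using 0 by (auto intro: continuous_on_compose2)
next
  case (Suc k)
  then have df: "f differentiable (at x)" for x by simp
  have "(\<lambda>x. f (g x)) differentiable (at x)" for x
    using differentiable_chain_at[OF linear_imp_differentiable[OF g] df, of x] by (simp add: o_def)
  moreover have "partial i (\<lambda>x. f (g x)) = (\<lambda>x. \<Sum>j\<in>UNIV. g (axis i 1) $ j * partial j f (g x))" for i
    using partial_compose_linear[OF g df] by (intro ext)
  moreover have "C_k k (\<lambda>x. \<Sum>j\<in>UNIV. g (axis i 1) $ j * partial j f (g x))" for i
    using Suc by (intro C_k_sum Suc.IH) auto
  ultimately show ?case by simp
qed

lemma test_function_C_k: "test_function \<phi> \<Longrightarrow> C_k k \<phi>"
  by (simp add: test_function_def)

lemma test_function_continuous: "test_function \<phi> \<Longrightarrow> continuous_on UNIV \<phi>"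
  using test_function_C_k[of \<phi> 0] by simp

lemma test_function_differentiable: "test_function \<phi> \<Longrightarrow> \<phi> differentiable (at x)"
  using test_function_C_k[of \<phi> "Suc 0"] by simp

lemma test_function_compose_orthogonal:
  fixes g :: "real^'n::finite \<Rightarrow> real^'n"
  assumes g: "orthogonal_transformation g" and \<phi>: "test_function \<phi>"
  shows "test_function (\<lambda>x. \<phi> (g x))"
  unfolding test_function_def
proof (intro conjI allI)
  show "C_k k (\<lambda>x. \<phi> (g x))" for k
    by (rule C_k_compose_linear[OF orthogonal_transformation_linear[OF g] test_function_C_k[OF \<phi>]])
  have "bounded {x. \<phi> x \<noteq> 0}"
    using \<phi> bounded_subset[OF compact_imp_bounded closure_subset] by (auto simp: test_function_def)
  then obtain B where "\<And>x. \<phi> x \<noteq> 0 \<Longrightarrow> norm x \<le> B" by (auto simp: bounded_iff)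
  then have "norm x \<le> B" if "\<phi> (g x) \<noteq> 0" for x
    using that orthogonal_transformation_norm[OF g] by metis
  then have "bounded {x. \<phi> (g x) \<noteq> 0}" by (auto simp: bounded_iff)
  then show "compact (closure {x. \<phi> (g x) \<noteq> 0})" by simp
qed

lemma test_function_partial:
  assumes \<phi>: "test_function \<phi>"
  shows "test_function (partial i \<phi>)"
  unfolding test_function_def
proof (intro conjI allI)
  show "C_k k (partial i \<phi>)" for k
    using test_function_C_k[OF \<phi>, of "Suc k"] by simp
  have "partial i \<phi> x = 0" if x: "x \<notin> closure {x. \<phi> x \<noteq> 0}" for x
  proof -
    have "frechet_derivative (\<lambda>x. 0) (at x) = frechet_derivative \<phi> (at x)"
      by (rule frechet_derivative_transform_within_open[where X = "- closure {x. \<phi> x \<noteq> 0}"])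
        (use x closure_subset[of "{x. \<phi> x \<noteq> 0}"] in auto)
    from this[symmetric] show ?thesis by (simp add: partial_def)
  qed
  then have "{x. partial i \<phi> x \<noteq> 0} \<subseteq> closure {x. \<phi> x \<noteq> 0}" by blast
  moreover have "bounded (closure {x. \<phi> x \<noteq> 0})"
    using \<phi> by (simp add: test_function_def compact_imp_bounded)
  ultimately have "bounded {x. partial i \<phi> x \<noteq> 0}" by (rule bounded_subset[rotated])
  then show "compact (closure {x. partial i \<phi> x \<noteq> 0})" by simp
qed

lemma test_function_L2:
  fixes \<phi> :: "real^'n::finite \<Rightarrow> real"
  assumes \<phi>: "test_function \<phi>"
  shows "\<phi> \<in> L2"
proof -
  define K where "K = closure {x. \<phi> x \<noteq> 0}"
  have K: "compact K" "\<And>x. x \<notin> K \<Longrightarrow> \<phi> x = 0"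
    using \<phi> closure_subset[of "{x. \<phi> x \<noteq> 0}"] by (auto simp: test_function_def K_def)
  have cont: "continuous_on A \<phi>" for A
    by (rule continuous_on_subset[OF test_function_continuous[OF \<phi>]]) simp
  have "integrable lborel (\<lambda>x. indicator K x *\<^sub>R (\<phi> x)\<^sup>2)"
    by (intro borel_integrable_compact K continuous_intros cont)
  moreover have "(\<lambda>x. indicator K x *\<^sub>R (\<phi> x)\<^sup>2) = (\<lambda>x. (\<phi> x)\<^sup>2)"
    using K(2) by (auto simp: fun_eq_iff indicator_def)
  ultimately show ?thesis
    using borel_measurable_continuous_onI[OF cont[of UNIV]] by (simp add: L2_def)
qed

lemmas test_function_partial_L2 = test_function_L2[OF test_function_partial]

lemma weak_partialD:
  "weak_partial i u g \<Longrightarrow> test_function \<phi> \<Longrightarrow>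
    (LINT x|lborel. u x * partial i \<phi> x) = - (LINT x|lborel. g x * \<phi> x)"
  by (simp add: weak_partial_def)

lemma weak_partial_cong_AE:
  assumes ae: "AE x in lborel. u x = u' x" "AE x in lborel. g x = g' x"
    and [measurable]: "u \<in> borel_measurable borel" "u' \<in> borel_measurable borel"
      "g \<in> borel_measurable borel" "g' \<in> borel_measurable borel"
    and w: "weak_partial i u g"
  shows "weak_partial i u' g'"
  unfolding weak_partial_def
proof (intro allI impI)
  fix \<phi> :: "real^'a \<Rightarrow> real" assume \<phi>: "test_function \<phi>"
  note [measurable] = L2_measurable[OF test_function_L2[OF \<phi>]]
    L2_measurable[OF test_function_partial_L2[OF \<phi>]]
  have "(LINT x|lborel. u' x * partial i \<phi> x) = (LINT x|lborel. u x * partial i \<phi> x)"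
    using ae(1) by (intro integral_cong_AE) auto
  also have "\<dots> = - (LINT x|lborel. g x * \<phi> x)" by (rule weak_partialD[OF w \<phi>])
  also have "(LINT x|lborel. g x * \<phi> x) = (LINT x|lborel. g' x * \<phi> x)"
    using ae(2) by (intro integral_cong_AE) auto
  finally show "(LINT x|lborel. u' x * partial i \<phi> x) = - (LINT x|lborel. g' x * \<phi> x)" .
qed

lemma weak_partial_unique:
  assumes "weak_partial i u g" "weak_partial i u g'" and L2: "g \<in> L2" "g' \<in> L2"
  shows "AE x in lborel. g x = g' x"
proof -
  have "AE x in lborel. g x - g' x = 0"
  proof (rule L2_eq_0_if_orthogonal_to_test_functions)
    fix \<phi> :: "real^'a \<Rightarrow> real" assume \<phi>: "test_function \<phi>"
    note int = L2_integrable_mult[OF L2(1) test_function_L2[OF \<phi>]]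
      L2_integrable_mult[OF L2(2) test_function_L2[OF \<phi>]]
    have "(LINT x|lborel. (g x - g' x) * \<phi> x) = (LINT x|lborel. g x * \<phi> x) - (LINT x|lborel. g' x * \<phi> x)"
      using int by (simp add: left_diff_distrib)
    also have "\<dots> = 0"
      using weak_partialD[OF assms(1) \<phi>] weak_partialD[OF assms(2) \<phi>] by simp
    finally show "(LINT x|lborel. (g x - g' x) * \<phi> x) = 0" .
  qed (intro L2_diff L2)
  then show ?thesis by eventually_elim simp
qed

lemma weak_partial_lincomb:
  assumes w: "weak_partial i u g" "weak_partial i v h"
    and L2: "u \<in> L2" "g \<in> L2" "v \<in> L2" "h \<in> L2"
  shows "weak_partial i (\<lambda>x. a * u x + b * v x) (\<lambda>x. a * g x + b * h x)"
  unfolding weak_partial_def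
proof (intro allI impI)
  fix \<phi> :: "real^'a \<Rightarrow> real" assume \<phi>: "test_function \<phi>"
  have lin: "(LINT x|lborel. (a * s x + b * t x) * \<psi> x)
      = a * (LINT x|lborel. s x * \<psi> x) + b * (LINT x|lborel. t x * \<psi> x)"
    if "s \<in> L2" "t \<in> L2" "\<psi> \<in> L2" for s t \<psi> :: "real^'a \<Rightarrow> real"
    using L2_integrable_mult[OF that(1,3)] L2_integrable_mult[OF that(2,3)]
    by (simp add: distrib_right mult.assoc)
  show "(LINT x|lborel. (a * u x + b * v x) * partial i \<phi> x) = - (LINT x|lborel. (a * g x + b * h x) * \<phi> x)"
    using L2 test_function_L2[OF \<phi>] test_function_partial_L2[OF \<phi>]
    by (simp add: lin weak_partialD[OF w(1) \<phi>] weak_partialD[OF w(2) \<phi>])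
qed

text \<open>Norm convergence implies weak convergence, by the Cauchy-Schwarz inequality.\<close>

lemma L2_tendsto_weak:
  assumes u: "\<And>n. u n \<in> L2" "v \<in> L2" and \<psi>: "\<psi> \<in> L2"
    and lim: "(\<lambda>n. LINT x|lborel. (u n x - v x)\<^sup>2) \<longlonglongrightarrow> 0"
  shows "(\<lambda>n. LINT x|lborel. u n x * \<psi> x) \<longlonglongrightarrow> (LINT x|lborel. v x * \<psi> x)"
proof -
  have diff: "(LINT x|lborel. u n x * \<psi> x) - (LINT x|lborel. v x * \<psi> x)
      = (LINT x|lborel. (u n x - v x) * \<psi> x)" for n
    using L2_integrable_mult[OF u(1)[of n] \<psi>] L2_integrable_mult[OF u(2) \<psi>]
    by (simp add: left_diff_distrib)
  have "(\<lambda>n. ((LINT x|lborel. u n x * \<psi> x) - (LINT x|lborel. v x * \<psi> x))\<^sup>2) \<longlonglongrightarrow> 0"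
  proof (rule Lim_null_comparison)
    show "\<forall>\<^sub>F n in sequentially. norm (((LINT x|lborel. u n x * \<psi> x) - (LINT x|lborel. v x * \<psi> x))\<^sup>2)
      \<le> (LINT x|lborel. (u n x - v x)\<^sup>2) * (LINT x|lborel. (\<psi> x)\<^sup>2)"
      unfolding diff using L2_Cauchy_Schwarz[OF L2_diff[OF u] \<psi>] by simp
    show "(\<lambda>n. (LINT x|lborel. (u n x - v x)\<^sup>2) * (LINT x|lborel. (\<psi> x)\<^sup>2)) \<longlonglongrightarrow> 0"
      by (rule tendsto_mult_left_zero[OF lim])
  qed
  then have "(\<lambda>n. (LINT x|lborel. u n x * \<psi> x) - (LINT x|lborel. v x * \<psi> x)) \<longlonglongrightarrow> 0"
    by (simp add: power_tendsto_0_iff)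
  then show ?thesis by (simp add: Lim_null[symmetric])
qed

lemma weak_partial_limit:
  assumes w: "\<And>n. weak_partial i (u n) (g n)"
    and L2: "\<And>n. u n \<in> L2" "\<And>n. g n \<in> L2" "v \<in> L2" "h \<in> L2"
    and lim: "(\<lambda>n. LINT x|lborel. (u n x - v x)\<^sup>2) \<longlonglongrightarrow> 0"
      "(\<lambda>n. LINT x|lborel. (g n x - h x)\<^sup>2) \<longlonglongrightarrow> 0"
  shows "weak_partial i v h"
  unfolding weak_partial_def
proof (intro allI impI)
  fix \<phi> :: "real^'a \<Rightarrow> real" assume \<phi>: "test_function \<phi>"
  have "(\<lambda>n. LINT x|lborel. u n x * partial i \<phi> x) \<longlonglongrightarrow> (LINT x|lborel. v x * partial i \<phi> x)"
    by (intro L2_tendsto_weak L2 lim test_function_partial_L2 \<phi>)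
  moreover have "(\<lambda>n. - (LINT x|lborel. g n x * \<phi> x)) \<longlonglongrightarrow> - (LINT x|lborel. h x * \<phi> x)"
    by (intro tendsto_minus L2_tendsto_weak L2 lim test_function_L2 \<phi>)
  ultimately show "(LINT x|lborel. v x * partial i \<phi> x) = - (LINT x|lborel. h x * \<phi> x)"
    using weak_partialD[OF w \<phi>] by (simp add: LIMSEQ_unique)
qed

text \<open>The change of variables \<open>x \<mapsto> g x\<close> transfers the classical chain rule from the test function
  \<open>\<phi> \<circ> inv g\<close> to the weak derivatives of \<open>u\<close>.\<close>

lemma weak_partial_orthogonal:
  fixes g :: "real^'n::finite \<Rightarrow> real^'n"
  assumes g: "orthogonal_transformation g"
    and w: "\<And>j. weak_partial j u (d j)" and L2: "u \<in> L2" "\<And>j. d j \<in> L2"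
  shows "weak_partial i (\<lambda>x. u (g x)) (\<lambda>x. \<Sum>j\<in>UNIV. g (axis i 1) $ j * d j (g x))"
  unfolding weak_partial_def
proof (intro allI impI)
  fix \<phi> :: "real^'n \<Rightarrow> real" assume \<phi>: "test_function \<phi>"
  define \<psi> where "\<psi> y = \<phi> (inv g y)" for y
  have \<psi>: "test_function \<psi>"
    unfolding \<psi>_def
    by (rule test_function_compose_orthogonal[OF orthogonal_transformation_inv[OF g] \<phi>])
  have \<phi>\<psi>: "\<phi> = (\<lambda>x. \<psi> (g x))"
    using orthogonal_transformation_inj[OF g] by (simp add: \<psi>_def)
  note [measurable] = L2_measurable[OF L2(1)] L2_measurable[OF L2(2)]
    L2_measurable[OF test_function_L2[OF \<psi>]] L2_measurable[OF test_function_partial_L2[OF \<psi>]]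
  have "(LINT x|lborel. u (g x) * partial i \<phi> x)
      = (LINT x|lborel. u (g x) * (\<Sum>j\<in>UNIV. g (axis i 1) $ j * partial j \<psi> (g x)))"
    unfolding \<phi>\<psi> using test_function_differentiable[OF \<psi>] g
    by (simp add: partial_compose_linear orthogonal_transformation_linear)
  also have "\<dots> = (LINT y|lborel. u y * (\<Sum>j\<in>UNIV. g (axis i 1) $ j * partial j \<psi> y))"
    by (rule integral_lborel_orthogonal[OF g]) measurable
  also have "\<dots> = (LINT y|lborel. (\<Sum>j\<in>UNIV. g (axis i 1) $ j * (u y * partial j \<psi> y)))"
    by (simp add: sum_distrib_left mult_ac)
  also have "\<dots> = (\<Sum>j\<in>UNIV. g (axis i 1) $ j * (LINT y|lborel. u y * partial j \<psi> y))"
    using L2_integrable_mult[OF L2(1) test_function_partial_L2[OF \<psi>]] by simp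
  also have "\<dots> = - (\<Sum>j\<in>UNIV. g (axis i 1) $ j * (LINT y|lborel. d j y * \<psi> y))"
    by (simp add: weak_partialD[OF w \<psi>] sum_negf)
  also have "(\<Sum>j\<in>UNIV. g (axis i 1) $ j * (LINT y|lborel. d j y * \<psi> y))
      = (LINT y|lborel. (\<Sum>j\<in>UNIV. g (axis i 1) $ j * (d j y * \<psi> y)))"
    using L2_integrable_mult[OF L2(2) test_function_L2[OF \<psi>]] by simp
  also have "\<dots> = (LINT y|lborel. (\<Sum>j\<in>UNIV. g (axis i 1) $ j * d j y) * \<psi> y)"
    by (simp only: sum_distrib_right mult.assoc)
  also have "\<dots> = (LINT x|lborel. (\<Sum>j\<in>UNIV. g (axis i 1) $ j * d j (g x)) * \<psi> (g x))"
    by (rule integral_lborel_orthogonal[OF g, symmetric]) measurable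
  finally show "(LINT x|lborel. u (g x) * partial i \<phi> x)
      = - (LINT x|lborel. (\<Sum>j\<in>UNIV. g (axis i 1) $ j * d j (g x)) * \<phi> x)"
    by (simp add: \<phi>\<psi>)
qed

section \<open>Functions with square-integrable weak derivatives up to order two\<close>

text \<open>A function together with some choice of its weak gradient and Hessian. Arbitrary representatives
  are allowed so that sums, limits and rotations of jets are again jets, by explicit formulas; the
  representatives chosen by \<open>D\<close> agree with them almost everywhere (\<open>jet_imp_D\<close>).\<close>

definition jet :: "(real^'n::finite \<Rightarrow> real) \<Rightarrow> ('n \<Rightarrow> real^'n \<Rightarrow> real) \<Rightarrow> ('n \<Rightarrow> 'n \<Rightarrow> real^'n \<Rightarrow> real) \<Rightarrow> bool" where
  "jet u d h \<longleftrightarrow> u \<in> L2 \<and> (\<forall>i. d i \<in> L2 \<and> weak_partial i u (d i)) \<and>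
     (\<forall>i j. h i j \<in> L2 \<and> weak_partial j (d i) (h i j))"

lemma jetD:
  assumes "jet u d h"
  shows "u \<in> L2" "d i \<in> L2" "weak_partial i u (d i)" "h i j \<in> L2" "weak_partial j (d i) (h i j)"
  using assms by (auto simp: jet_def)

lemma D_eq_AE:
  assumes "g \<in> L2" "weak_partial i u g"
  shows "D i u \<in> L2" "weak_partial i u (D i u)" "AE x in lborel. D i u x = g x"
proof -
  have "D i u \<in> L2 \<and> weak_partial i u (D i u)"
    unfolding D_def by (rule someI[of _ g]) (use assms in simp)
  then show *: "D i u \<in> L2" "weak_partial i u (D i u)" by simp_all
  show "AE x in lborel. D i u x = g x"
    by (rule weak_partial_unique[OF *(2) assms(2) *(1) assms(1)])
qed

text \<open>Equality holds outright, since both choices are made from the same set of candidates. This is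
  why \<open>D j (D i u)\<close> may be computed from any representative of the first derivative.\<close>

lemma D_cong_AE:
  assumes "AE x in lborel. u x = v x" "u \<in> borel_measurable borel" "v \<in> borel_measurable borel"
  shows "D i u = D i v"
proof -
  have "AE x in lborel. v x = u x" using assms(1) by eventually_elim simp
  then have "(\<lambda>g. g \<in> L2 \<and> weak_partial i u g) = (\<lambda>g. g \<in> L2 \<and> weak_partial i v g)"
    using weak_partial_cong_AE[OF assms(1) AE_I2[OF refl] assms(2,3)]
      weak_partial_cong_AE[OF _ AE_I2[OF refl] assms(3,2)]
    by (intro ext) (auto dest: L2_measurable)
  then show ?thesis unfolding D_def by simp
qed

lemma jet_imp_D:
  assumes J: "jet u d h"
  shows "jet u (\<lambda>i. D i u) (\<lambda>i j. D j (D i u))"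
    and "AE x in lborel. D i u x = d i x" and "AE x in lborel. D j (D i u) x = h i j x"
proof -
  note J' = jetD[OF J]
  have 1: "D i u \<in> L2" "weak_partial i u (D i u)" "AE x in lborel. D i u x = d i x" for i
    by (rule D_eq_AE[OF J'(2,3)])+
  have eq: "D j (D i u) = D j (d i)" for i j
    by (rule D_cong_AE[OF 1(3)]) (auto intro: L2_measurable 1 J')
  have 2: "D j (d i) \<in> L2" "weak_partial j (d i) (D j (d i))" "AE x in lborel. D j (d i) x = h i j x" for i j
    by (rule D_eq_AE[OF J'(4,5)])+
  have "weak_partial j (D i u) (D j (d i))" for i j
  proof (rule weak_partial_cong_AE[OF _ AE_I2[OF refl] _ _ _ _ 2(2)])
    show "AE x in lborel. d i x = D i u x" using 1(3)[of i] by eventually_elim simp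
  qed (auto intro: L2_measurable 1 2 J')
  then show "jet u (\<lambda>i. D i u) (\<lambda>i j. D j (D i u))"
    using 1 2 J'(1) by (simp add: jet_def eq)
  show "AE x in lborel. D i u x = d i x" by (rule 1)
  show "AE x in lborel. D j (D i u) x = h i j x" unfolding eq by (rule 2)
qed

lemma W22_iff_jet: "u \<in> W22 \<longleftrightarrow> (\<exists>d h. jet u d h)"
proof
  assume u: "u \<in> W22"
  then have "\<forall>i. \<exists>g. g \<in> L2 \<and> weak_partial i u g \<and> (\<forall>j. \<exists>h. h \<in> L2 \<and> weak_partial j g h)"
    unfolding W22_def by (simp add: Bex_def)
  then obtain d where d: "\<And>i. d i \<in> L2 \<and> weak_partial i u (d i) \<and> (\<forall>j. \<exists>h. h \<in> L2 \<and> weak_partial j (d i) h)"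
    by metis
  then obtain h where "\<And>i j. h i j \<in> L2 \<and> weak_partial j (d i) (h i j)" by metis
  with d u show "\<exists>d h. jet u d h" by (auto simp: jet_def W22_def)
next
  assume "\<exists>d h. jet u d h"
  then obtain d h where J: "jet u d h" by blast
  have "d i \<in> L2 \<and> weak_partial i u (d i) \<and> (\<forall>j. \<exists>h\<in>L2. weak_partial j (d i) h)" for i
    using jetD(2-5)[OF J] by blast
  then show "u \<in> W22"
    unfolding W22_def using jetD(1)[OF J] by blast
qed

lemma W22_jet: "u \<in> W22 \<Longrightarrow> jet u (\<lambda>i. D i u) (\<lambda>i j. D j (D i u))"
  using W22_iff_jet jet_imp_D(1) by blast

lemma jet_W22: "jet u d h \<Longrightarrow> u \<in> W22"
  using W22_iff_jet by blast

lemma W22_L2: "u \<in> W22 \<Longrightarrow> u \<in> L2"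
  by (simp add: W22_def)

lemma jet_lincomb:
  assumes "jet u d h" "jet v e k"
  shows "jet (\<lambda>x. a * u x + b * v x) (\<lambda>i x. a * d i x + b * e i x) (\<lambda>i j x. a * h i j x + b * k i j x)"
  unfolding jet_def
  by (intro conjI allI L2_lincomb weak_partial_lincomb jetD[OF assms(1)] jetD[OF assms(2)])

lemma jet_orthogonal:
  fixes g :: "real^'n::finite \<Rightarrow> real^'n"
  assumes g: "orthogonal_transformation g" and J: "jet u d h"
  shows "jet (\<lambda>x. u (g x)) (\<lambda>i x. \<Sum>j\<in>UNIV. g (axis i 1) $ j * d j (g x))
    (\<lambda>i l x. \<Sum>j\<in>UNIV. g (axis i 1) $ j * (\<Sum>k\<in>UNIV. g (axis l 1) $ k * h j k (g x)))"
proof -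
  note J' = jetD[OF J]
  have wsum: "weak_partial l (\<lambda>x. \<Sum>j\<in>I. c j * f j x) (\<lambda>x. \<Sum>j\<in>I. c j * f' j x)"
    if "finite I" "\<And>j. f j \<in> L2" "\<And>j. f' j \<in> L2" "\<And>j. weak_partial l (f j) (f' j)" for I l f f' and c :: "'a \<Rightarrow> real"
    using that(1)
  proof (induction I)
    case empty
    show ?case by (simp add: weak_partial_def)
  next
    case (insert j I)
    have "weak_partial l (\<lambda>x. c j * f j x + 1 * (\<Sum>j\<in>I. c j * f j x))
        (\<lambda>x. c j * f' j x + 1 * (\<Sum>j\<in>I. c j * f' j x))"
      by (intro weak_partial_lincomb that insert L2_sum L2_cmult)
    then show ?case using insert by simp
  qed
  have L2d: "(\<lambda>x. d j (g x)) \<in> L2" and L2h: "(\<lambda>x. \<Sum>k\<in>UNIV. c k * h j k (g x)) \<in> L2" for j c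
    by (intro L2_sum L2_cmult L2_orthogonal[OF g] J')+
  show ?thesis
    unfolding jet_def
  proof (intro conjI allI)
    show "weak_partial l (\<lambda>x. \<Sum>j\<in>UNIV. g (axis i 1) $ j * d j (g x))
      (\<lambda>x. \<Sum>j\<in>UNIV. g (axis i 1) $ j * (\<Sum>k\<in>UNIV. g (axis l 1) $ k * h j k (g x)))" for i l
      by (intro wsum L2d L2h weak_partial_orthogonal[OF g J'(5,2,4)]) simp
    show "(\<lambda>x. \<Sum>j\<in>UNIV. g (axis i 1) $ j * d j (g x)) \<in> L2" for i
      by (intro L2_sum L2_cmult L2d)
    show "(\<lambda>x. \<Sum>j\<in>UNIV. g (axis i 1) $ j * (\<Sum>k\<in>UNIV. g (axis l 1) $ k * h j k (g x))) \<in> L2" for i l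
      by (intro L2_sum L2_cmult L2h)
  qed (auto intro: L2_orthogonal[OF g] weak_partial_orthogonal[OF g] J')
qed

text \<open>Parseval's identity for the orthonormal basis of the vectors \<open>g (axis i 1)\<close>.\<close>

lemma orthogonal_sum_columns:
  fixes g :: "real^'n::finite \<Rightarrow> real^'n"
  assumes g: "orthogonal_transformation g"
  shows "(\<Sum>i\<in>UNIV. (g (axis i 1) \<bullet> a) * (g (axis i 1) \<bullet> b)) = a \<bullet> b"
proof -
  obtain a' b' where "a = g a'" "b = g b'"
    using orthogonal_transformation_surj[OF g] by (metis surjD)
  moreover have "g v \<bullet> g w = v \<bullet> w" for v w
    using g by (simp add: orthogonal_transformation_def)
  ultimately have "(\<Sum>i\<in>UNIV. (g (axis i 1) \<bullet> a) * (g (axis i 1) \<bullet> b)) = (\<Sum>i\<in>UNIV. a' $ i * b' $ i)"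
    "a \<bullet> b = a' \<bullet> b'" by (simp_all add: inner_axis')
  then show ?thesis by (simp add: inner_vec_def)
qed

lemma orthogonal_sum_squares:
  fixes g :: "real^'n::finite \<Rightarrow> real^'n"
  assumes g: "orthogonal_transformation g"
  shows "(\<Sum>i\<in>UNIV. (\<Sum>j\<in>UNIV. g (axis i 1) $ j * a j)\<^sup>2) = (\<Sum>j\<in>UNIV. (a j)\<^sup>2)"
  using orthogonal_sum_columns[OF g, of "\<chi> j. a j" "\<chi> j. a j"]
  by (simp add: inner_vec_def power2_eq_square)

lemma orthogonal_trace:
  fixes g :: "real^'n::finite \<Rightarrow> real^'n"
  assumes g: "orthogonal_transformation g"
  shows "(\<Sum>i\<in>UNIV. \<Sum>j\<in>UNIV. g (axis i 1) $ j * (\<Sum>k\<in>UNIV. g (axis i 1) $ k * h j k)) = (\<Sum>j\<in>UNIV. h j j)"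
proof -
  have delta: "(\<Sum>i\<in>UNIV. g (axis i 1) $ j * g (axis i 1) $ k) = (if j = k then 1 else 0)" for j k
  proof -
    have "axis j (1 :: real) $ k = (if j = k then 1 else 0)" by (simp add: axis_def)
    then show ?thesis
      using orthogonal_sum_columns[OF g, of "axis j 1" "axis k 1"] by (simp add: inner_axis)
  qed
  have "(\<Sum>i\<in>UNIV. \<Sum>j\<in>UNIV. g (axis i 1) $ j * (\<Sum>k\<in>UNIV. g (axis i 1) $ k * h j k))
      = (\<Sum>i\<in>UNIV. \<Sum>j\<in>UNIV. \<Sum>k\<in>UNIV. g (axis i 1) $ j * g (axis i 1) $ k * h j k)"
    by (simp add: sum_distrib_left mult.assoc)
  also have "\<dots> = (\<Sum>j\<in>UNIV. \<Sum>i\<in>UNIV. \<Sum>k\<in>UNIV. g (axis i 1) $ j * g (axis i 1) $ k * h j k)"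
    by (rule sum.swap)
  also have "\<dots> = (\<Sum>j\<in>UNIV. \<Sum>k\<in>UNIV. \<Sum>i\<in>UNIV. g (axis i 1) $ j * g (axis i 1) $ k * h j k)"
    by (intro sum.cong refl sum.swap)
  also have "\<dots> = (\<Sum>j\<in>UNIV. \<Sum>k\<in>UNIV. (if j = k then 1 else 0) * h j k)"
    by (simp only: sum_distrib_right[symmetric] delta)
  finally show ?thesis by (simp add: if_distrib[of "\<lambda>z. z * _"] sum.delta cong: if_cong)
qed

text \<open>The square of the full Sobolev norm. It is minimized instead of \<open>normsq\<close> because a Cauchy
  sequence for it has, directly from its form, Cauchy sequences of derivatives.\<close>

definition sobolev_sq :: "(real^'n::finite \<Rightarrow> real) \<Rightarrow> real" where
  "sobolev_sq u = (LINT x|lborel. (u x)\<^sup>2) + (\<Sum>i\<in>UNIV. LINT x|lborel. (D i u x)\<^sup>2)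
     + (\<Sum>i\<in>UNIV. \<Sum>j\<in>UNIV. LINT x|lborel. (D j (D i u) x)\<^sup>2)"

lemma L2_integral_cong_AE:
  "AE x in lborel. f x = g x \<Longrightarrow> f \<in> L2 \<Longrightarrow> g \<in> L2 \<Longrightarrow>
    (LINT x|lborel. (f x)\<^sup>2) = (LINT x|lborel. (g x)\<^sup>2)"
  by (intro integral_cong_AE) (auto dest: L2_measurable)

lemma sobolev_sq_jet:
  assumes J: "jet u d h"
  shows "sobolev_sq u = (LINT x|lborel. (u x)\<^sup>2) + (\<Sum>i\<in>UNIV. LINT x|lborel. (d i x)\<^sup>2)
     + (\<Sum>i\<in>UNIV. \<Sum>j\<in>UNIV. LINT x|lborel. (h i j x)\<^sup>2)"
proof -
  note 1 = jetD[OF J] and 2 = jetD[OF jet_imp_D(1)[OF J]]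
  have "(LINT x|lborel. (D i u x)\<^sup>2) = (LINT x|lborel. (d i x)\<^sup>2)" for i
    by (intro L2_integral_cong_AE jet_imp_D(2)[OF J] 1 2)
  moreover have "(LINT x|lborel. (D j (D i u) x)\<^sup>2) = (LINT x|lborel. (h i j x)\<^sup>2)" for i j
    by (intro L2_integral_cong_AE jet_imp_D(3)[OF J] 1 2)
  ultimately show ?thesis by (simp add: sobolev_sq_def)
qed

lemma laplacian_jet:
  assumes J: "jet u d h"
  shows "AE x in lborel. laplacian u x = (\<Sum>i\<in>UNIV. h i i x)"
proof -
  have "AE x in lborel. \<forall>i\<in>UNIV. D i (D i u) x = h i i x"
    by (intro AE_finite_allI jet_imp_D(3)[OF J]) simp
  then show ?thesis by eventually_elim (simp add: laplacian_def)
qed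

lemma laplacian_L2: "u \<in> W22 \<Longrightarrow> laplacian u \<in> L2"
  unfolding laplacian_def[abs_def] by (intro L2_sum) (rule jetD(4)[OF W22_jet])

lemma sobolev_sq_nonneg: "0 \<le> sobolev_sq u"
  by (auto simp: sobolev_sq_def intro!: add_nonneg_nonneg sum_nonneg)

lemma L2_le_sobolev_sq: "(LINT x|lborel. (u x)\<^sup>2) \<le> sobolev_sq u"
proof -
  have "0 \<le> (\<Sum>i\<in>UNIV. LINT x|lborel. (D i u x)\<^sup>2)"
    "0 \<le> (\<Sum>i\<in>UNIV. \<Sum>j\<in>UNIV. LINT x|lborel. (D j (D i u) x)\<^sup>2)"
    by (auto intro!: sum_nonneg)
  then show ?thesis unfolding sobolev_sq_def by linarith
qed

lemma W22_lincomb: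
  assumes "u \<in> W22" "v \<in> W22"
  shows "(\<lambda>x. a * u x + b * v x) \<in> W22"
  by (rule jet_W22[OF jet_lincomb[OF W22_jet[OF assms(1)] W22_jet[OF assms(2)]]])

lemma laplacian_lincomb:
  assumes "u \<in> W22" "v \<in> W22"
  shows "AE x in lborel. laplacian (\<lambda>x. a * u x + b * v x) x = a * laplacian u x + b * laplacian v x"
  using laplacian_jet[OF jet_lincomb[OF W22_jet[OF assms(1)] W22_jet[OF assms(2)]]]
  by eventually_elim (simp add: laplacian_def sum.distrib sum_distrib_left)

lemma W22_orthogonal:
  fixes g :: "real^'n::finite \<Rightarrow> real^'n"
  assumes "orthogonal_transformation g" "u \<in> W22"
  shows "(\<lambda>x. u (g x)) \<in> W22"
  by (rule jet_W22[OF jet_orthogonal[OF assms(1) W22_jet[OF assms(2)]]])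

text \<open>The Hessian is conjugated by \<open>g\<close>, which preserves the trace.\<close>

lemma laplacian_orthogonal:
  fixes g :: "real^'n::finite \<Rightarrow> real^'n"
  assumes g: "orthogonal_transformation g" and u: "u \<in> W22"
  shows "AE x in lborel. laplacian (\<lambda>x. u (g x)) x = laplacian u (g x)"
  using laplacian_jet[OF jet_orthogonal[OF g W22_jet[OF u]]]
  by eventually_elim (simp add: orthogonal_trace[OF g] laplacian_def)

text \<open>Conjugating the Hessian by \<open>g\<close> multiplies it by an orthogonal matrix from either side. Each
  multiplication preserves the sum of the squared entries, so the same identity is applied twice.\<close>

lemma sobolev_sq_orthogonal:
  fixes g :: "real^'n::finite \<Rightarrow> real^'n"
  assumes g: "orthogonal_transformation g" and u: "u \<in> W22"
  shows "sobolev_sq (\<lambda>x. u (g x)) = sobolev_sq u"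
proof -
  define d where "d i = D i u" for i
  define h where "h i j = D j (D i u)" for i j
  have J: "jet u d h" using W22_jet[OF u] by (simp add: d_def[abs_def] h_def[abs_def])
  note J' = jetD[OF J]
  have inv: "(LINT x|lborel. (f (g x))\<^sup>2) = (LINT x|lborel. (f x)\<^sup>2)" if "f \<in> L2" for f
    using integral_lborel_orthogonal[OF g, of "\<lambda>x. (f x)\<^sup>2"] L2_measurable[OF that] by simp
  have rot: "(\<Sum>i\<in>UNIV. LINT x|lborel. (\<Sum>j\<in>UNIV. g (axis i 1) $ j * f j x)\<^sup>2)
      = (\<Sum>j\<in>UNIV. LINT x|lborel. (f j x)\<^sup>2)" if f: "\<And>j. f j \<in> L2" for f
  proof -
    have "(\<Sum>i\<in>UNIV. LINT x|lborel. (\<Sum>j\<in>UNIV. g (axis i 1) $ j * f j x)\<^sup>2)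
        = (LINT x|lborel. (\<Sum>i\<in>UNIV. (\<Sum>j\<in>UNIV. g (axis i 1) $ j * f j x)\<^sup>2))"
      by (intro Bochner_Integration.integral_sum[symmetric] L2_integrable_square L2_sum L2_cmult f)
    also have "\<dots> = (LINT x|lborel. (\<Sum>j\<in>UNIV. (f j x)\<^sup>2))"
      by (simp only: orthogonal_sum_squares[OF g])
    also have "\<dots> = (\<Sum>j\<in>UNIV. LINT x|lborel. (f j x)\<^sup>2)"
      by (intro Bochner_Integration.integral_sum L2_integrable_square f)
    finally show ?thesis .
  qed
  have "(\<Sum>i\<in>UNIV. \<Sum>l\<in>UNIV. LINT x|lborel. (\<Sum>j\<in>UNIV. g (axis i 1) $ j * (\<Sum>k\<in>UNIV. g (axis l 1) $ k * h j k (g x)))\<^sup>2)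
      = (\<Sum>l\<in>UNIV. \<Sum>i\<in>UNIV. LINT x|lborel. (\<Sum>j\<in>UNIV. g (axis i 1) $ j * (\<Sum>k\<in>UNIV. g (axis l 1) $ k * h j k (g x)))\<^sup>2)"
    by (rule sum.swap)
  also have "\<dots> = (\<Sum>l\<in>UNIV. \<Sum>j\<in>UNIV. LINT x|lborel. (\<Sum>k\<in>UNIV. g (axis l 1) $ k * h j k (g x))\<^sup>2)"
    by (intro sum.cong refl rot L2_sum L2_cmult L2_orthogonal[OF g] J')
  also have "\<dots> = (\<Sum>j\<in>UNIV. \<Sum>l\<in>UNIV. LINT x|lborel. (\<Sum>k\<in>UNIV. g (axis l 1) $ k * h j k (g x))\<^sup>2)"
    by (rule sum.swap)
  also have "\<dots> = (\<Sum>j\<in>UNIV. \<Sum>k\<in>UNIV. LINT x|lborel. (h j k (g x))\<^sup>2)"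
    by (intro sum.cong refl rot L2_orthogonal[OF g] J')
  finally have hess: "(\<Sum>i\<in>UNIV. \<Sum>l\<in>UNIV. LINT x|lborel. (\<Sum>j\<in>UNIV. g (axis i 1) $ j * (\<Sum>k\<in>UNIV. g (axis l 1) $ k * h j k (g x)))\<^sup>2)
      = (\<Sum>j\<in>UNIV. \<Sum>k\<in>UNIV. LINT x|lborel. (h j k x)\<^sup>2)"
    by (simp add: inv J')
  have grad: "(\<Sum>i\<in>UNIV. LINT x|lborel. (\<Sum>j\<in>UNIV. g (axis i 1) $ j * d j (g x))\<^sup>2)
      = (\<Sum>j\<in>UNIV. LINT x|lborel. (d j x)\<^sup>2)"
    by (subst rot) (auto intro: L2_orthogonal[OF g] J' simp: inv[OF J'(2)])
  show ?thesis
    unfolding sobolev_sq_jet[OF jet_orthogonal[OF g J]] sobolev_sq_jet[OF J]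
    by (simp only: hess grad inv[OF J'(1)])
qed

lemma sobolev_sq_parallelogram:
  assumes u: "u \<in> W22" and v: "v \<in> W22"
  shows "sobolev_sq (\<lambda>x. u x + v x) + sobolev_sq (\<lambda>x. u x - v x) = 2 * sobolev_sq u + 2 * sobolev_sq v"
proof -
  define d where "d i = D i u" for i
  define h where "h i j = D j (D i u)" for i j
  define e where "e i = D i v" for i
  define k where "k i j = D j (D i v)" for i j
  have J: "jet u d h" using W22_jet[OF u] by (simp add: d_def[abs_def] h_def[abs_def])
  have K: "jet v e k" using W22_jet[OF v] by (simp add: e_def[abs_def] k_def[abs_def])
  note J' = jetD[OF J] and K' = jetD[OF K]
  have para: "(LINT x|lborel. (f x + g x)\<^sup>2) + (LINT x|lborel. (f x - g x)\<^sup>2)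
      = 2 * (LINT x|lborel. (f x)\<^sup>2) + 2 * (LINT x|lborel. (g x)\<^sup>2)" if "f \<in> L2" "g \<in> L2" for f g :: "real^'a \<Rightarrow> real"
    using L2_square_lincomb[OF that, of 1 1] L2_square_lincomb[OF that, of 1 "-1"] by simp
  have "sobolev_sq (\<lambda>x. u x + v x) + sobolev_sq (\<lambda>x. u x - v x)
    = ((LINT x|lborel. (u x + v x)\<^sup>2) + (LINT x|lborel. (u x - v x)\<^sup>2))
      + (\<Sum>i\<in>UNIV. (LINT x|lborel. (d i x + e i x)\<^sup>2) + (LINT x|lborel. (d i x - e i x)\<^sup>2))
      + (\<Sum>i\<in>UNIV. \<Sum>j\<in>UNIV. (LINT x|lborel. (h i j x + k i j x)\<^sup>2) + (LINT x|lborel. (h i j x - k i j x)\<^sup>2))"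
    using sobolev_sq_jet[OF jet_lincomb[OF J K, of 1 1]] sobolev_sq_jet[OF jet_lincomb[OF J K, of 1 "-1"]]
    by (simp add: sum.distrib)
  also have "\<dots> = 2 * sobolev_sq u + 2 * sobolev_sq v"
    by (simp add: para J' K' sobolev_sq_jet[OF J] sobolev_sq_jet[OF K] sum.distrib
        sum_distrib_left[symmetric] distrib_left)
  finally show ?thesis .
qed

lemma sobolev_sq_cmult:
  assumes u: "u \<in> W22"
  shows "sobolev_sq (\<lambda>x. c * u x) = c\<^sup>2 * sobolev_sq u"
  using sobolev_sq_jet[OF jet_lincomb[OF W22_jet[OF u] W22_jet[OF u], of c 0]]
  by (simp add: sobolev_sq_jet[OF W22_jet[OF u]] power_mult_distrib sum_distrib_left distrib_left)

text \<open>Function, gradient and Hessian are Cauchy sequences in \<open>L\<^sup>2\<close>; their limits form a jet since weak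
  derivatives pass to limits.\<close>

lemma W22_complete:
  fixes u :: "nat \<Rightarrow> real^'n::finite \<Rightarrow> real"
  assumes u: "\<And>n. u n \<in> W22"
    and Cauchy: "\<And>e. e > 0 \<Longrightarrow> \<exists>N. \<forall>m\<ge>N. \<forall>n\<ge>N. sobolev_sq (\<lambda>x. u m x - u n x) < e"
  shows "\<exists>v\<in>W22. (\<lambda>n. sobolev_sq (\<lambda>x. u n x - v x)) \<longlonglongrightarrow> 0"
proof -
  define d where "d n i = D i (u n)" for n i
  define h where "h n i j = D j (D i (u n))" for n i j
  have J: "jet (u n) (d n) (h n)" for n
    using W22_jet[OF u] by (simp add: d_def[abs_def] h_def[abs_def])
  note J' = jetD[OF J]
  have diff: "sobolev_sq (\<lambda>x. u m x - v x) = (LINT x|lborel. (u m x - v x)\<^sup>2)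
     + (\<Sum>i\<in>UNIV. LINT x|lborel. (d m i x - e i x)\<^sup>2)
     + (\<Sum>i\<in>UNIV. \<Sum>j\<in>UNIV. LINT x|lborel. (h m i j x - k i j x)\<^sup>2)" if "jet v e k" for m v e k
    using sobolev_sq_jet[OF jet_lincomb[OF J[of m] that, of 1 "-1"]] by simp
  have d_le: "(LINT x|lborel. (d m i x - d n i x)\<^sup>2) \<le> sobolev_sq (\<lambda>x. u m x - u n x)" for m n i
  proof -
    have "(LINT x|lborel. (d m i x - d n i x)\<^sup>2) \<le> (\<Sum>i\<in>UNIV. LINT x|lborel. (d m i x - d n i x)\<^sup>2)"
      by (rule member_le_sum) auto
    also have "\<dots> \<le> sobolev_sq (\<lambda>x. u m x - u n x)"
      unfolding diff[OF J] by (simp add: sum_nonneg add_nonneg_nonneg)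
    finally show ?thesis .
  qed
  have h_le: "(LINT x|lborel. (h m i j x - h n i j x)\<^sup>2) \<le> sobolev_sq (\<lambda>x. u m x - u n x)" for m n i j
  proof -
    have "(LINT x|lborel. (h m i j x - h n i j x)\<^sup>2) \<le> (\<Sum>j\<in>UNIV. LINT x|lborel. (h m i j x - h n i j x)\<^sup>2)"
      by (rule member_le_sum) auto
    also have "\<dots> \<le> (\<Sum>i\<in>UNIV. \<Sum>j\<in>UNIV. LINT x|lborel. (h m i j x - h n i j x)\<^sup>2)"
      by (rule member_le_sum[of i UNIV "\<lambda>i. \<Sum>j\<in>UNIV. LINT x|lborel. (h m i j x - h n i j x)\<^sup>2"])
        (auto intro!: sum_nonneg)
    also have "\<dots> \<le> sobolev_sq (\<lambda>x. u m x - u n x)"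
      unfolding diff[OF J] by (simp add: sum_nonneg add_nonneg_nonneg)
    finally show ?thesis .
  qed
  have compl: "\<exists>v\<in>L2. (\<lambda>n. LINT x|lborel. (f n x - v x)\<^sup>2) \<longlonglongrightarrow> 0"
    if f: "\<And>n. f n \<in> L2" and le: "\<And>m n. (LINT x|lborel. (f m x - f n x)\<^sup>2) \<le> sobolev_sq (\<lambda>x. u m x - u n x)"
    for f :: "nat \<Rightarrow> real^'n \<Rightarrow> real"
  proof (rule L2_complete[OF f])
    fix e :: real assume "e > 0"
    then show "\<exists>N. \<forall>m\<ge>N. \<forall>n\<ge>N. (LINT x|lborel. (f m x - f n x)\<^sup>2) < e"
      using Cauchy le by (meson le_less_trans)
  qed
  obtain v where v: "v \<in> L2" "(\<lambda>n. LINT x|lborel. (u n x - v x)\<^sup>2) \<longlonglongrightarrow> 0"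
    using compl[of u, OF J'(1) L2_le_sobolev_sq] by blast
  have "\<forall>i. \<exists>e. e \<in> L2 \<and> (\<lambda>n. LINT x|lborel. (d n i x - e x)\<^sup>2) \<longlonglongrightarrow> 0"
    using compl[of "\<lambda>n. d n i" for i, OF J'(2) d_le] unfolding Bex_def by blast
  from choice[OF this] obtain e where
    e: "\<And>i. e i \<in> L2" "\<And>i. (\<lambda>n. LINT x|lborel. (d n i x - e i x)\<^sup>2) \<longlonglongrightarrow> 0"
    by blast
  have "\<forall>j. \<exists>k. k \<in> L2 \<and> (\<lambda>n. LINT x|lborel. (h n i j x - k x)\<^sup>2) \<longlonglongrightarrow> 0" for i
    using compl[of "\<lambda>n. h n i j" for j, OF J'(4) h_le] unfolding Bex_def by blast
  then have "\<forall>i. \<exists>k. \<forall>j. k j \<in> L2 \<and> (\<lambda>n. LINT x|lborel. (h n i j x - k j x)\<^sup>2) \<longlonglongrightarrow> 0"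
  proof (intro allI)
    fix i
    assume "\<And>i. \<forall>j. \<exists>k. k \<in> L2 \<and> (\<lambda>n. LINT x|lborel. (h n i j x - k x)\<^sup>2) \<longlonglongrightarrow> 0"
    from choice[OF this[of i]]
    show "\<exists>k. \<forall>j. k j \<in> L2 \<and> (\<lambda>n. LINT x|lborel. (h n i j x - k j x)\<^sup>2) \<longlonglongrightarrow> 0" .
  qed
  from choice[OF this] obtain k where
    k: "\<And>i j. k i j \<in> L2" "\<And>i j. (\<lambda>n. LINT x|lborel. (h n i j x - k i j x)\<^sup>2) \<longlonglongrightarrow> 0"
    by blast
  have K: "jet v e k"
    unfolding jet_def
  proof (intro conjI allI v e k)
    show "weak_partial i v (e i)" for i
      by (rule weak_partial_limit[OF J'(3) J'(1,2) v(1) e(1) v(2) e(2)])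
    show "weak_partial j (e i) (k i j)" for i j
      by (rule weak_partial_limit[OF J'(5) J'(2,4) e(1) k(1) e(2) k(2)])
  qed
  have "(\<lambda>n. sobolev_sq (\<lambda>x. u n x - v x)) \<longlonglongrightarrow> 0 + (\<Sum>i\<in>(UNIV::'n set). 0) + (\<Sum>i\<in>(UNIV::'n set). \<Sum>j\<in>(UNIV::'n set). 0)"
    unfolding diff[OF K] by (intro tendsto_add tendsto_sum v e k)
  then show ?thesis using jet_W22[OF K] by auto
qed

section \<open>The principle of symmetric criticality\<close>

lemma W22_diff: "u \<in> W22 \<Longrightarrow> v \<in> W22 \<Longrightarrow> (\<lambda>x. u x - v x) \<in> W22"
  using W22_lincomb[of u v 1 "-1"] by simp

lemma W22_add: "u \<in> W22 \<Longrightarrow> v \<in> W22 \<Longrightarrow> (\<lambda>x. u x + v x) \<in> W22"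
  using W22_lincomb[of u v 1 1] by simp

lemma W22_cmult: "u \<in> W22 \<Longrightarrow> (\<lambda>x. c * u x) \<in> W22"
  using W22_lincomb[of u u c 0] by simp

lemma sobolev_sq_add_le:
  assumes "u \<in> W22" "v \<in> W22"
  shows "sobolev_sq (\<lambda>x. u x + v x) \<le> 2 * sobolev_sq u + 2 * sobolev_sq v"
  using sobolev_sq_parallelogram[OF assms] sobolev_sq_nonneg[of "\<lambda>x. u x - v x"] by linarith

lemma sobolev_sq_commute:
  assumes "u \<in> W22" "v \<in> W22"
  shows "sobolev_sq (\<lambda>x. u x - v x) = sobolev_sq (\<lambda>x. v x - u x)"
  using sobolev_sq_cmult[OF W22_diff[OF assms], of "-1"] by simp

text \<open>A minimizing sequence \<open>h\<^sub>n\<close> of \<open>sobolev_sq\<close> on \<open>\<Lambda> = 1\<close> is Cauchy by the parallelogram identity,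
  because midpoints stay in this affine space. Its limit \<open>v\<close> is invariant: \<open>h\<^sub>n\<close> and
  \<open>h\<^sub>n \<circ> g\<close> are equally good competitors, so the same estimate makes their distance tend to zero.\<close>

lemma symmetric_criticality:
  fixes \<Lambda> :: "(real^'n::finite \<Rightarrow> real) \<Rightarrow> real"
  assumes dim: "CARD('n) \<ge> 2"
    and lin: "\<And>u v a b. u \<in> W22 \<Longrightarrow> v \<in> W22 \<Longrightarrow> \<Lambda> (\<lambda>x. a * u x + b * v x) = a * \<Lambda> u + b * \<Lambda> v"
    and bounded: "\<And>u. u \<in> W22 \<Longrightarrow> (\<Lambda> u)\<^sup>2 \<le> C * sobolev_sq u"
    and inv: "\<And>g u. orthogonal_transformation g \<Longrightarrow> u \<in> W22 \<Longrightarrow> \<Lambda> (\<lambda>x. u (g x)) = \<Lambda> u"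
    and rad: "\<And>u. u \<in> W22_rad \<Longrightarrow> \<Lambda> u = 0"
    and u: "u \<in> W22"
  shows "\<Lambda> u = 0"
proof (rule ccontr)
  assume nz: "\<Lambda> u \<noteq> 0"
  define K where "K = {h \<in> W22. \<Lambda> h = 1}"
  have "(\<lambda>x. (1 / \<Lambda> u) * u x + 0 * u x) \<in> K"
    unfolding K_def using W22_lincomb[OF u u, of "1 / \<Lambda> u" 0] lin[OF u u, of "1 / \<Lambda> u" 0] nz by simp
  then have "K \<noteq> {}" by blast
  define m where "m = Inf (sobolev_sq ` K)"
  have m_le: "m \<le> sobolev_sq h" if "h \<in> K" for h
    unfolding m_def by (rule cInf_lower) (use that sobolev_sq_nonneg in \<open>auto intro!: bdd_belowI2\<close>)
  \<comment> \<open>The parallelogram identity with the midpoint of p and q as a competitor.\<close>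
  have gap: "sobolev_sq (\<lambda>x. p x - q x) \<le> 2 * sobolev_sq p + 2 * sobolev_sq q - 4 * m"
    if p: "p \<in> K" and q: "q \<in> K" for p q
  proof -
    have W: "p \<in> W22" "q \<in> W22" using p q by (auto simp: K_def)
    have "(\<lambda>x. (1/2) * p x + (1/2) * q x) \<in> K"
      using p q W22_lincomb[OF W, of "1/2" "1/2"] lin[OF W, of "1/2" "1/2"] by (simp add: K_def)
    from m_le[OF this] sobolev_sq_cmult[OF W22_lincomb[OF W, of "1/2" "1/2"], of 2]
    have "4 * m \<le> sobolev_sq (\<lambda>x. p x + q x)" by (simp add: distrib_left)
    then show ?thesis using sobolev_sq_parallelogram[OF W] by linarith
  qed
  have "\<exists>h\<in>K. sobolev_sq h < m + 1 / real (Suc n)" for n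
  proof -
    have "Inf (sobolev_sq ` K) < m + 1 / real (Suc n)" by (simp add: m_def)
    then show ?thesis using cInf_lessD[of "sobolev_sq ` K"] \<open>K \<noteq> {}\<close> by blast
  qed
  then obtain h where h: "\<And>n. h n \<in> K" "\<And>n. sobolev_sq (h n) < m + 1 / real (Suc n)" by metis
  have hW: "h n \<in> W22" and h1: "\<Lambda> (h n) = 1" for n using h(1) by (auto simp: K_def)
  have "\<exists>v\<in>W22. (\<lambda>n. sobolev_sq (\<lambda>x. h n x - v x)) \<longlonglongrightarrow> 0"
  proof (rule W22_complete[OF hW])
    fix e :: real assume "e > 0"
    then obtain N where N: "1 / real (Suc N) < e / 4"
      using reals_Archimedean[of "e / 4"] by (auto simp: inverse_eq_divide)
    have "sobolev_sq (\<lambda>x. h a x - h b x) < e" if "a \<ge> N" "b \<ge> N" for a b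
    proof -
      have "1 / real (Suc a) \<le> 1 / real (Suc N)" "1 / real (Suc b) \<le> 1 / real (Suc N)"
        using that by (auto intro!: divide_left_mono)
      then show ?thesis using gap[OF h(1)[of a] h(1)[of b]] h(2)[of a] h(2)[of b] N by linarith
    qed
    then show "\<exists>N. \<forall>a\<ge>N. \<forall>b\<ge>N. sobolev_sq (\<lambda>x. h a x - h b x) < e" by blast
  qed
  then obtain v where v: "v \<in> W22" and lim: "(\<lambda>n. sobolev_sq (\<lambda>x. h n x - v x)) \<longlonglongrightarrow> 0" by blast
  have "\<Lambda> v = 1"
  proof -
    have "(1 - \<Lambda> v)\<^sup>2 \<le> C * sobolev_sq (\<lambda>x. h n x - v x)" for n
      using bounded[OF W22_diff[OF hW v], of n] lin[of "h n" v 1 "-1", OF hW v] h1[of n] by simp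
    moreover have "(\<lambda>n. C * sobolev_sq (\<lambda>x. h n x - v x)) \<longlonglongrightarrow> C * 0"
      by (intro tendsto_intros lim)
    ultimately have "(1 - \<Lambda> v)\<^sup>2 \<le> C * 0" by (intro LIMSEQ_le_const) auto
    then show ?thesis by simp
  qed
  have "AE x in lborel. v (g x) = v x" if g: "orthogonal_transformation g" for g
  proof -
    have vg: "(\<lambda>x. v (g x)) \<in> W22" by (rule W22_orthogonal[OF g v])
    have hg: "(\<lambda>x. h n (g x)) \<in> K" for n
      using W22_orthogonal[OF g hW] inv[OF g hW] h1 by (simp add: K_def)
    then have hgW: "(\<lambda>x. h n (g x)) \<in> W22" for n by (simp add: K_def)
    define s where "s n = sobolev_sq (\<lambda>x. h n x - v x)" for n
    have "sobolev_sq (\<lambda>x. v x - v (g x)) \<le> 6 * s n + 16 * (1 / real (Suc n))" for n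
    proof -
      have "sobolev_sq (\<lambda>x. (v x - h n x) + ((h n x - h n (g x)) + (h n (g x) - v (g x))))
        \<le> 2 * sobolev_sq (\<lambda>x. v x - h n x) + 2 * sobolev_sq (\<lambda>x. (h n x - h n (g x)) + (h n (g x) - v (g x)))"
        by (intro sobolev_sq_add_le W22_add W22_diff v vg hW hgW)
      moreover have "sobolev_sq (\<lambda>x. (h n x - h n (g x)) + (h n (g x) - v (g x)))
        \<le> 2 * sobolev_sq (\<lambda>x. h n x - h n (g x)) + 2 * sobolev_sq (\<lambda>x. h n (g x) - v (g x))"
        by (intro sobolev_sq_add_le W22_diff v vg hW hgW)
      moreover have "sobolev_sq (\<lambda>x. v x - h n x) = s n"
        unfolding s_def by (rule sobolev_sq_commute[OF v hW])
      moreover have "sobolev_sq (\<lambda>x. h n (g x) - v (g x)) = s n"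
        unfolding s_def by (rule sobolev_sq_orthogonal[OF g W22_diff[OF hW v]])
      moreover have "sobolev_sq (\<lambda>x. h n x - h n (g x)) \<le> 4 * (1 / real (Suc n))"
        using gap[OF h(1)[of n] hg[of n]] h(2)[of n] sobolev_sq_orthogonal[OF g hW[of n]] by linarith
      ultimately show ?thesis by simp
    qed
    moreover have "(\<lambda>n. 6 * s n + 16 * (1 / real (Suc n))) \<longlonglongrightarrow> 6 * 0 + 16 * 0"
      unfolding s_def by (intro tendsto_intros lim LIMSEQ_Suc[OF lim_1_over_n])
    ultimately have "sobolev_sq (\<lambda>x. v x - v (g x)) \<le> 6 * 0 + 16 * 0"
      by (intro LIMSEQ_le_const) auto
    then have "(LINT x|lborel. (v x - v (g x))\<^sup>2) = 0"
      using L2_le_sobolev_sq[of "\<lambda>x. v x - v (g x)"] by (intro antisym) auto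
    then have "AE x in lborel. (v x - v (g x))\<^sup>2 = 0"
      using L2_integrable_square[OF W22_L2[OF W22_diff[OF v vg]]]
      by (subst (asm) integral_nonneg_eq_0_iff_AE) auto
    then show ?thesis by eventually_elim simp
  qed
  then have "\<exists>f. AE x in lborel. v x = f (norm x)"
    using dim by (intro radial_if_invariant L2_measurable[OF W22_L2[OF v]]) auto
  then have "v \<in> W22_rad" using v by (simp add: W22_rad_def)
  then show False using rad \<open>\<Lambda> v = 1\<close> by simp
qed

section \<open>The quadratic part of the energy\<close>

text \<open>The polarization of \<open>normsq\<close>.\<close>

definition energy_form :: "real \<Rightarrow> (real^'n::finite \<Rightarrow> real) \<Rightarrow> (real^'n \<Rightarrow> real) \<Rightarrow> real" where
  "energy_form lam u v = (LINT x|lborel. laplacian u x * laplacian v x) + lam * (LINT x|lborel. u x * v x)"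

lemma normsq_lincomb:
  assumes u: "u \<in> W22" and v: "v \<in> W22"
  shows "normsq lam (\<lambda>x. a * u x + b * v x)
    = a\<^sup>2 * normsq lam u + 2 * a * b * energy_form lam u v + b\<^sup>2 * normsq lam v"
proof -
  have "(LINT x|lborel. (laplacian (\<lambda>x. a * u x + b * v x) x)\<^sup>2)
      = (LINT x|lborel. (a * laplacian u x + b * laplacian v x)\<^sup>2)"
    by (intro L2_integral_cong_AE laplacian_lincomb laplacian_L2 L2_lincomb W22_lincomb u v)
  then show ?thesis
    unfolding normsq_def energy_form_def
    by (simp add: L2_square_lincomb[OF laplacian_L2[OF u] laplacian_L2[OF v]]
        L2_square_lincomb[OF W22_L2[OF u] W22_L2[OF v]] algebra_simps)
qed

lemma normsq_cmult: "u \<in> W22 \<Longrightarrow> normsq lam (\<lambda>x. c * u x) = c\<^sup>2 * normsq lam u"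
  using normsq_lincomb[of u u lam c 0] by simp

lemma energy_form_lincomb:
  assumes w: "w \<in> W22" and u: "u \<in> W22" and v: "v \<in> W22"
  shows "energy_form lam w (\<lambda>x. a * u x + b * v x) = a * energy_form lam w u + b * energy_form lam w v"
proof -
  have lin: "(LINT x|lborel. r x * (a * s x + b * t x)) = a * (LINT x|lborel. r x * s x) + b * (LINT x|lborel. r x * t x)"
    if "r \<in> L2" "s \<in> L2" "t \<in> L2" for r s t :: "real^'a \<Rightarrow> real"
  proof -
    have "(\<lambda>x. r x * (a * s x + b * t x)) = (\<lambda>x. a * (r x * s x) + b * (r x * t x))"
      by (simp add: fun_eq_iff algebra_simps)
    then show ?thesis using L2_integrable_mult[OF that(1,2)] L2_integrable_mult[OF that(1,3)] by simp
  qed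
  have "(LINT x|lborel. laplacian w x * laplacian (\<lambda>x. a * u x + b * v x) x)
      = (LINT x|lborel. laplacian w x * (a * laplacian u x + b * laplacian v x))"
  proof (rule integral_cong_AE)
    show "AE x in lborel. laplacian w x * laplacian (\<lambda>x. a * u x + b * v x) x
        = laplacian w x * (a * laplacian u x + b * laplacian v x)"
      using laplacian_lincomb[OF u v, of a b] by eventually_elim simp
  qed (use L2_measurable[OF laplacian_L2[OF w]] L2_measurable[OF laplacian_L2[OF u]]
      L2_measurable[OF laplacian_L2[OF v]] L2_measurable[OF laplacian_L2[OF W22_lincomb[OF u v, of a b]]] in auto)
  also have "\<dots> = a * (LINT x|lborel. laplacian w x * laplacian u x)
      + b * (LINT x|lborel. laplacian w x * laplacian v x)"
    by (intro lin laplacian_L2 w u v)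
  finally show ?thesis
    unfolding energy_form_def lin[OF W22_L2[OF w] W22_L2[OF u] W22_L2[OF v]]
    by (simp only: distrib_left mult.left_commute add_ac)
qed

lemma normsq_nonneg: "lam \<ge> 0 \<Longrightarrow> 0 \<le> normsq lam u"
  by (simp add: normsq_def)

lemma normsq_orthogonal:
  fixes g :: "real^'n::finite \<Rightarrow> real^'n"
  assumes g: "orthogonal_transformation g" and u: "u \<in> W22"
  shows "normsq lam (\<lambda>x. u (g x)) = normsq lam u"
proof -
  have inv: "(LINT x|lborel. (f (g x))\<^sup>2) = (LINT x|lborel. (f x)\<^sup>2)" if "f \<in> L2" for f
    using integral_lborel_orthogonal[OF g, of "\<lambda>x. (f x)\<^sup>2"] L2_measurable[OF that] by simp
  have "(LINT x|lborel. (laplacian (\<lambda>x. u (g x)) x)\<^sup>2) = (LINT x|lborel. (laplacian u (g x))\<^sup>2)"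
    by (rule L2_integral_cong_AE[OF laplacian_orthogonal[OF g u]
        laplacian_L2[OF W22_orthogonal[OF g u]] L2_orthogonal[OF g laplacian_L2[OF u]]])
  then show ?thesis
    unfolding normsq_def by (simp add: inv[OF laplacian_L2[OF u]] inv[OF W22_L2[OF u]])
qed

lemma normsq_cong_AE:
  assumes ae: "AE x in lborel. u x = v x" and u: "u \<in> W22" and v: "v \<in> W22"
  shows "normsq lam u = normsq lam v"
proof -
  have "laplacian u = laplacian v"
    unfolding laplacian_def[abs_def]
    using D_cong_AE[OF ae L2_measurable[OF W22_L2[OF u]] L2_measurable[OF W22_L2[OF v]]] by simp
  moreover have "(LINT x|lborel. (u x)\<^sup>2) = (LINT x|lborel. (v x)\<^sup>2)"
    by (intro L2_integral_cong_AE ae W22_L2 u v)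
  ultimately show ?thesis by (simp add: normsq_def)
qed

lemma normsq_le_sobolev_sq:
  fixes u :: "real^'n::finite \<Rightarrow> real"
  assumes u: "u \<in> W22" and lam: "lam \<ge> 0"
  shows "normsq lam u \<le> (real CARD('n) + lam) * sobolev_sq u"
proof -
  define h where "h i j = D j (D i u)" for i j
  have hL2: "h i j \<in> L2" for i j unfolding h_def by (rule jetD(4)[OF W22_jet[OF u]])
  have "(LINT x|lborel. (laplacian u x)\<^sup>2) \<le> (LINT x|lborel. real CARD('n) * (\<Sum>i\<in>UNIV. (h i i x)\<^sup>2))"
  proof (rule integral_mono)
    show "integrable lborel (\<lambda>x. (laplacian u x)\<^sup>2)"
      by (rule L2_integrable_square[OF laplacian_L2[OF u]])
    show "integrable lborel (\<lambda>x. real CARD('n) * (\<Sum>i\<in>UNIV. (h i i x)\<^sup>2))"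
      by (intro integrable_mult_right Bochner_Integration.integrable_sum L2_integrable_square hL2)
    show "(laplacian u x)\<^sup>2 \<le> real CARD('n) * (\<Sum>i\<in>UNIV. (h i i x)\<^sup>2)" for x
      using Cauchy_Schwarz_ineq_sum[of "\<lambda>_. 1" "\<lambda>i. h i i x" UNIV]
      by (simp add: laplacian_def h_def)
  qed
  also have "\<dots> = real CARD('n) * (\<Sum>i\<in>UNIV. LINT x|lborel. (h i i x)\<^sup>2)"
    using L2_integrable_square[OF hL2] by simp
  also have "\<dots> \<le> real CARD('n) * sobolev_sq u"
  proof (rule mult_left_mono)
    have "(LINT x|lborel. (h i i x)\<^sup>2) \<le> (\<Sum>j\<in>UNIV. LINT x|lborel. (h i j x)\<^sup>2)" for i
      by (rule member_le_sum) auto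
    then have "(\<Sum>i\<in>UNIV. LINT x|lborel. (h i i x)\<^sup>2) \<le> (\<Sum>i\<in>UNIV. \<Sum>j\<in>UNIV. LINT x|lborel. (h i j x)\<^sup>2)"
      by (rule sum_mono)
    also have "\<dots> \<le> sobolev_sq u"
      unfolding sobolev_sq_def h_def by (simp add: sum_nonneg add_nonneg_nonneg)
    finally show "(\<Sum>i\<in>UNIV. LINT x|lborel. (h i i x)\<^sup>2) \<le> sobolev_sq u" .
  qed simp
  finally show ?thesis
    using mult_left_mono[OF L2_le_sobolev_sq lam, of u] unfolding normsq_def by (simp add: distrib_right)
qed

lemma EE_components: "u \<in> EE \<longleftrightarrow> fst u \<in> W22 \<and> snd u \<in> W22"
  by (cases u) (simp add: EE_def)

lemma EE_lincomb: "u \<in> EE \<Longrightarrow> h \<in> EE \<Longrightarrow> scale a u + scale b h \<in> EE"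
  by (simp add: EE_components scale_def plus_fun_def W22_lincomb)

lemma scale_1: "scale 1 u = u"
  by (simp add: scale_def)

lemma EE_scale: "u \<in> EE \<Longrightarrow> scale c u \<in> EE"
  by (simp add: EE_components scale_def W22_cmult)

lemma EE_add: "u \<in> EE \<Longrightarrow> h \<in> EE \<Longrightarrow> u + h \<in> EE"
  using EE_lincomb[of u h 1 1] by (simp add: scale_1)

lemma HH_subset_EE: "HH \<subseteq> EE"
  by (auto simp: HH_def EE_def W22_rad_def)

lemma pair_norm_sq:
  assumes "lam1 > 0" "lam2 > 0"
  shows "(pair_norm lam1 lam2 u)\<^sup>2 = normsq lam1 (fst u) + normsq lam2 (snd u)"
  using assms by (simp add: pair_norm_def normsq_nonneg)

lemma pair_norm_nonneg:
  assumes "lam1 > 0" "lam2 > 0"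
  shows "0 \<le> pair_norm lam1 lam2 u"
  using assms by (simp add: pair_norm_def normsq_nonneg)

lemma pair_norm_scale:
  assumes "u \<in> EE"
  shows "pair_norm lam1 lam2 (scale c u) = \<bar>c\<bar> * pair_norm lam1 lam2 u"
proof -
  have "normsq lam1 (fst (scale c u)) + normsq lam2 (snd (scale c u))
      = c\<^sup>2 * (normsq lam1 (fst u) + normsq lam2 (snd u))"
    using assms by (simp add: scale_def EE_components normsq_cmult distrib_left)
  then show ?thesis by (simp add: pair_norm_def real_sqrt_mult)
qed

definition pair_form :: "real \<Rightarrow> real \<Rightarrow> 'n::finite fpair \<Rightarrow> 'n fpair \<Rightarrow> real" where
  "pair_form lam1 lam2 u h = energy_form lam1 (fst u) (fst h) + energy_form lam2 (snd u) (snd h)"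

lemma pair_norm_sq_lincomb:
  assumes lam: "lam1 > 0" "lam2 > 0" and u: "u \<in> EE" and h: "h \<in> EE"
  shows "(pair_norm lam1 lam2 (u + scale t h))\<^sup>2
    = (pair_norm lam1 lam2 u)\<^sup>2 + 2 * t * pair_form lam1 lam2 u h + t\<^sup>2 * (pair_norm lam1 lam2 h)\<^sup>2"
proof -
  have fst: "fst (u + scale t h) = (\<lambda>x. 1 * fst u x + t * fst h x)"
    and snd: "snd (u + scale t h) = (\<lambda>x. 1 * snd u x + t * snd h x)"
    by (simp_all add: scale_def plus_fun_def)
  have W: "fst u \<in> W22" "snd u \<in> W22" "fst h \<in> W22" "snd h \<in> W22"
    using u h by (simp_all add: EE_components)
  show ?thesis
    unfolding pair_norm_sq[OF lam] pair_form_def fst snd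
      normsq_lincomb[OF W(1,3)] normsq_lincomb[OF W(2,4)]
    by (simp add: algebra_simps)
qed

lemma pair_norm_sq_add:
  assumes "lam1 > 0" "lam2 > 0" "u \<in> EE" "h \<in> EE"
  shows "(pair_norm lam1 lam2 (u + h))\<^sup>2
    = (pair_norm lam1 lam2 u)\<^sup>2 + 2 * pair_form lam1 lam2 u h + (pair_norm lam1 lam2 h)\<^sup>2"
  using pair_norm_sq_lincomb[OF assms, of 1] by (simp add: scale_1)

lemma pair_form_lincomb:
  assumes u: "u \<in> EE" and h: "h \<in> EE" and k: "k \<in> EE"
  shows "pair_form lam1 lam2 u (scale a h + scale b k) = a * pair_form lam1 lam2 u h + b * pair_form lam1 lam2 u k"
proof -
  have "energy_form lam1 (fst u) (\<lambda>x. a * fst h x + b * fst k x) = a * energy_form lam1 (fst u) (fst h) + b * energy_form lam1 (fst u) (fst k)"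
    "energy_form lam2 (snd u) (\<lambda>x. a * snd h x + b * snd k x) = a * energy_form lam2 (snd u) (snd h) + b * energy_form lam2 (snd u) (snd k)"
    using assms by (auto simp: EE_components intro!: energy_form_lincomb)
  then show ?thesis by (simp add: pair_form_def scale_def plus_fun_def distrib_left)
qed

lemma pair_form_bound:
  assumes lam: "lam1 > 0" "lam2 > 0" and "u \<in> EE" "h \<in> EE"
  shows "\<bar>pair_form lam1 lam2 u h\<bar> \<le> pair_norm lam1 lam2 u * pair_norm lam1 lam2 h"
proof -
  have "(pair_form lam1 lam2 u h)\<^sup>2 \<le> (pair_norm lam1 lam2 u)\<^sup>2 * (pair_norm lam1 lam2 h)\<^sup>2"
    by (rule quadratic_nonneg_discriminant) (simp_all flip: pair_norm_sq_lincomb[OF assms])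
  then have "\<bar>pair_form lam1 lam2 u h\<bar>\<^sup>2 \<le> (pair_norm lam1 lam2 u * pair_norm lam1 lam2 h)\<^sup>2"
    by (simp add: power_mult_distrib)
  then show ?thesis
    by (rule power2_le_imp_le) (simp add: pair_norm_nonneg[OF lam])
qed

section \<open>Derivatives of the functionals\<close>

text \<open>Used to identify values of a Frechet derivative, because a derivative in one real variable is
  unique. Adding 1 to the norm of \<open>h\<close> in the estimates covers the case
  that it is zero.\<close>

lemma has_frechet_imp_directional:
  assumes lam: "lam1 > 0" "lam2 > 0"
    and L: "has_frechet lam1 lam2 f L u" and h: "h \<in> EE"
  shows "((\<lambda>t. f (u + scale t h)) has_real_derivative L h) (at 0)"
  unfolding has_field_derivative_iff
proof (rule LIM_I)
  fix r :: real assume r: "r > 0"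
  define P where "P = pair_norm lam1 lam2 h"
  have P: "P \<ge> 0" unfolding P_def by (rule pair_norm_nonneg[OF lam])
  have Lt: "L (scale t h) = t * L h" for t using L h by (simp add: has_frechet_def)
  have "r / (P + 1) > 0" using r P by simp
  then obtain \<delta> where \<delta>: "\<delta> > 0" "\<And>k. k \<in> EE \<Longrightarrow> pair_norm lam1 lam2 k < \<delta> \<Longrightarrow>
      \<bar>f (u + k) - f u - L k\<bar> \<le> r / (P + 1) * pair_norm lam1 lam2 k"
    using L unfolding has_frechet_def by blast
  have u0: "u + scale 0 h = u"
    by (cases u) (simp add: scale_def plus_fun_def)
  have "norm ((f (u + scale t h) - f (u + scale 0 h)) / (t - 0) - L h) < r"
    if t: "t \<noteq> 0" "norm (t - 0) < \<delta> / (P + 1)" for t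
  proof -
    have pn: "pair_norm lam1 lam2 (scale t h) = \<bar>t\<bar> * P"
      unfolding P_def by (rule pair_norm_scale[OF h])
    have "\<bar>t\<bar> * P \<le> \<bar>t\<bar> * (P + 1)" by (intro mult_left_mono) auto
    also have "\<dots> < \<delta>" using t P by (simp add: pos_less_divide_eq)
    finally have "\<bar>f (u + scale t h) - f u - t * L h\<bar> \<le> r / (P + 1) * (\<bar>t\<bar> * P)"
      using \<delta>(2)[OF EE_scale[OF h], of t] by (simp add: pn Lt)
    also have "\<dots> < r * \<bar>t\<bar>" using r P t by (simp add: divide_simps)
    finally have "\<bar>f (u + scale t h) - f u - t * L h\<bar> / \<bar>t\<bar> < r"
      using t by (simp add: divide_simps)
    moreover have "(f (u + scale t h) - f (u + scale 0 h)) / (t - 0) - L h = (f (u + scale t h) - f u - t * L h) / t"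
      using t by (simp add: u0 diff_divide_distrib)
    ultimately show ?thesis by (simp add: abs_divide)
  qed
  moreover have "\<delta> / (P + 1) > 0" using \<delta> P by simp
  ultimately show "\<exists>s>0. \<forall>t. t \<noteq> 0 \<and> norm (t - 0) < s \<longrightarrow>
      norm ((f (u + scale t h) - f (u + scale 0 h)) / (t - 0) - L h) < r" by blast
qed

lemma Psi_eq_J:
  "Psi lam1 lam2 mu1 mu2 \<beta> u = 4 * J lam1 lam2 mu1 mu2 \<beta> u - (pair_norm lam1 lam2 u)\<^sup>2"
  by (simp add: Psi_def J_def)

text \<open>Since \<open>\<Psi> = 4 J - \<parallel>\<cdot>\<parallel>\<^sup>2\<close>, the remainder for \<open>\<Psi>\<close> is four times the remainder for \<open>J\<close>, less
  \<open>\<parallel>h\<parallel>\<^sup>2\<close>. The radius \<open>\<epsilon> / 2\<close> bounds the square by \<open>\<epsilon> / 2 * \<parallel>h\<parallel>\<close>.\<close>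

lemma has_frechet_Psi:
  assumes lam: "lam1 > 0" "lam2 > 0" and u: "u \<in> EE"
    and L: "has_frechet lam1 lam2 (J lam1 lam2 mu1 mu2 \<beta>) L u"
  shows "has_frechet lam1 lam2 (Psi lam1 lam2 mu1 mu2 \<beta>) (\<lambda>h. 4 * L h - 2 * pair_form lam1 lam2 u h) u"
  unfolding has_frechet_def
proof (intro conjI ballI allI impI)
  fix h :: "'a fpair" assume h: "h \<in> EE"
  show "4 * L (h + k) - 2 * pair_form lam1 lam2 u (h + k)
      = (4 * L h - 2 * pair_form lam1 lam2 u h) + (4 * L k - 2 * pair_form lam1 lam2 u k)" if k: "k \<in> EE" for k
    using L h k pair_form_lincomb[OF u h k, of lam1 lam2 1 1]
    by (simp add: has_frechet_def scale_1)
  fix c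
  have "scale c h + scale 0 h = scale c h" by (simp add: scale_def plus_fun_def)
  then show "4 * L (scale c h) - 2 * pair_form lam1 lam2 u (scale c h) = c * (4 * L h - 2 * pair_form lam1 lam2 u h)"
    using L h pair_form_lincomb[OF u h h, of lam1 lam2 c 0]
    by (simp add: has_frechet_def algebra_simps)
next
  obtain C where C: "\<And>h. h \<in> EE \<Longrightarrow> \<bar>L h\<bar> \<le> C * pair_norm lam1 lam2 h"
    using L unfolding has_frechet_def by blast
  have "\<bar>4 * L h - 2 * pair_form lam1 lam2 u h\<bar> \<le> (4 * C + 2 * pair_norm lam1 lam2 u) * pair_norm lam1 lam2 h"
    if "h \<in> EE" for h
    using C[OF that] pair_form_bound[OF lam u that] unfolding distrib_right by linarith
  then show "\<exists>C. \<forall>h\<in>EE. \<bar>4 * L h - 2 * pair_form lam1 lam2 u h\<bar> \<le> C * pair_norm lam1 lam2 h" by blast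
next
  fix \<epsilon> :: real assume \<epsilon>: "\<epsilon> > 0"
  then have "\<epsilon> / 8 > 0" by simp
  then obtain \<delta> where \<delta>: "\<delta> > 0" "\<And>h. h \<in> EE \<Longrightarrow> pair_norm lam1 lam2 h < \<delta> \<Longrightarrow>
      \<bar>J lam1 lam2 mu1 mu2 \<beta> (u + h) - J lam1 lam2 mu1 mu2 \<beta> u - L h\<bar> \<le> \<epsilon> / 8 * pair_norm lam1 lam2 h"
    using L unfolding has_frechet_def by blast
  have "\<bar>Psi lam1 lam2 mu1 mu2 \<beta> (u + h) - Psi lam1 lam2 mu1 mu2 \<beta> u - (4 * L h - 2 * pair_form lam1 lam2 u h)\<bar>
      \<le> \<epsilon> * pair_norm lam1 lam2 h"
    if h: "h \<in> EE" "pair_norm lam1 lam2 h < min \<delta> (\<epsilon> / 2)" for h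
  proof -
    define p where "p = pair_norm lam1 lam2 h"
    have p: "0 \<le> p" "p \<le> \<epsilon> / 2" "p < \<delta>" using h pair_norm_nonneg[OF lam, of h] by (auto simp: p_def)
    have "p\<^sup>2 \<le> \<epsilon> / 2 * p" unfolding power2_eq_square using p by (intro mult_right_mono)
    moreover have "0 \<le> p\<^sup>2" by simp
    moreover have "\<bar>J lam1 lam2 mu1 mu2 \<beta> (u + h) - J lam1 lam2 mu1 mu2 \<beta> u - L h\<bar> \<le> \<epsilon> / 8 * p"
      using \<delta>(2)[OF h(1)] p by (simp add: p_def)
    ultimately show ?thesis
      using pair_norm_sq_add[OF lam u h(1)] unfolding Psi_eq_J p_def[symmetric] by linarith
  qed
  then show "\<exists>\<delta>>0. \<forall>h\<in>EE. pair_norm lam1 lam2 h < \<delta> \<longrightarrow>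
      \<bar>Psi lam1 lam2 mu1 mu2 \<beta> (u + h) - Psi lam1 lam2 mu1 mu2 \<beta> u - (4 * L h - 2 * pair_form lam1 lam2 u h)\<bar>
      \<le> \<epsilon> * pair_norm lam1 lam2 h"
    using \<delta>(1) \<epsilon> by (intro exI[of _ "min \<delta> (\<epsilon> / 2)"]) auto
qed

lemma F_scale: "F mu1 mu2 (scale c u) = c ^ 4 * F mu1 mu2 u"
proof -
  have "(\<lambda>x. mu1 * (c * fst u x) ^ 4 + mu2 * (c * snd u x) ^ 4)
      = (\<lambda>x. c ^ 4 * (mu1 * fst u x ^ 4 + mu2 * snd u x ^ 4))"
    by (simp add: fun_eq_iff power_mult_distrib distrib_left mult.left_commute)
  then show ?thesis by (simp add: F_def scale_def)
qed

lemma G_scale: "G (scale c u) = c ^ 4 * G u"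
proof -
  have "(\<lambda>x. (c * fst u x)\<^sup>2 * (c * snd u x)\<^sup>2) = (\<lambda>x. c ^ 4 * ((fst u x)\<^sup>2 * (snd u x)\<^sup>2))"
    by (simp add: fun_eq_iff power_mult_distrib power2_eq_square power4_eq_xxxx mult_ac)
  then show ?thesis by (simp add: G_def scale_def)
qed

lemma add_scale_self: "u + scale t u = scale (1 + t) u"
  by (cases u) (simp add: scale_def plus_fun_def algebra_simps)

text \<open>On multiples of \<open>u\<close> the energy is \<open>c\<^sup>2 / 2 * P - c ^ 4 * Q\<close> with \<open>P\<close> the squared norm and \<open>Q\<close> the
  quartic part. This holds even where the quartic integrals diverge, since the Bochner integral is
  homogeneous in every case.\<close>

lemma scaling_derivatives:
  assumes lam: "lam1 > 0" "lam2 > 0" and u: "u \<in> EE"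
  shows "((\<lambda>t. J lam1 lam2 mu1 mu2 \<beta> (u + scale t u)) has_real_derivative Psi lam1 lam2 mu1 mu2 \<beta> u) (at 0)"
    and "((\<lambda>t. Psi lam1 lam2 mu1 mu2 \<beta> (u + scale t u)) has_real_derivative
      4 * Psi lam1 lam2 mu1 mu2 \<beta> u - 2 * (pair_norm lam1 lam2 u)\<^sup>2) (at 0)"
proof -
  define P where "P = (pair_norm lam1 lam2 u)\<^sup>2"
  define Q where "Q = F mu1 mu2 u + \<beta> * G u"
  have P: "(pair_norm lam1 lam2 (scale c u))\<^sup>2 = c\<^sup>2 * P" for c
    by (simp add: pair_norm_scale[OF u] power_mult_distrib P_def)
  have J: "J lam1 lam2 mu1 mu2 \<beta> (u + scale t u) = (1 + t)\<^sup>2 / 2 * P - (1 + t) ^ 4 * Q" for t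
    by (simp add: add_scale_self J_def P F_scale G_scale Q_def algebra_simps)
  have Psi: "Psi lam1 lam2 mu1 mu2 \<beta> u = P - 4 * Q"
    by (simp add: Psi_def P_def Q_def)
  show 1: "((\<lambda>t. J lam1 lam2 mu1 mu2 \<beta> (u + scale t u)) has_real_derivative Psi lam1 lam2 mu1 mu2 \<beta> u) (at 0)"
    unfolding J Psi by (auto intro!: derivative_eq_intros)
  have "((\<lambda>t. (pair_norm lam1 lam2 (u + scale t u))\<^sup>2) has_real_derivative 2 * P) (at 0)"
    unfolding add_scale_self P by (auto intro!: derivative_eq_intros)
  then show "((\<lambda>t. Psi lam1 lam2 mu1 mu2 \<beta> (u + scale t u)) has_real_derivative
      4 * Psi lam1 lam2 mu1 mu2 \<beta> u - 2 * (pair_norm lam1 lam2 u)\<^sup>2) (at 0)"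
    unfolding Psi_eq_J[of _ _ _ _ _ "u + _"] P_def[symmetric]
    by (intro DERIV_diff DERIV_cmult 1)
qed

section \<open>Invariance of the energy and its derivative\<close>

definition rotate :: "(real^'n::finite \<Rightarrow> real^'n) \<Rightarrow> 'n fpair \<Rightarrow> 'n fpair" where
  "rotate g u = ((\<lambda>x. fst u (g x)), (\<lambda>x. snd u (g x)))"

lemma EE_measurable:
  "u \<in> EE \<Longrightarrow> fst u \<in> borel_measurable borel" "u \<in> EE \<Longrightarrow> snd u \<in> borel_measurable borel"
  by (auto simp: EE_components intro: L2_measurable W22_L2)

lemma EE_rotate: "orthogonal_transformation g \<Longrightarrow> u \<in> EE \<Longrightarrow> rotate g u \<in> EE"
  by (simp add: EE_components rotate_def W22_orthogonal)

lemma J_rotate: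
  fixes g :: "real^'n::finite \<Rightarrow> real^'n"
  assumes g: "orthogonal_transformation g" and u: "u \<in> EE"
  shows "J lam1 lam2 mu1 mu2 \<beta> (rotate g u) = J lam1 lam2 mu1 mu2 \<beta> u"
proof -
  note [measurable] = EE_measurable[OF u]
  have "pair_norm lam1 lam2 (rotate g u) = pair_norm lam1 lam2 u"
    using u by (simp add: pair_norm_def rotate_def normsq_orthogonal[OF g] EE_components)
  moreover have "F mu1 mu2 (rotate g u) = F mu1 mu2 u"
    using integral_lborel_orthogonal[OF g, of "\<lambda>x. mu1 * (fst u x)^4 + mu2 * (snd u x)^4"]
    by (simp add: F_def rotate_def)
  moreover have "G (rotate g u) = G u"
    using integral_lborel_orthogonal[OF g, of "\<lambda>x. (fst u x)\<^sup>2 * (snd u x)\<^sup>2"]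
    by (simp add: G_def rotate_def)
  ultimately show ?thesis by (simp add: J_def)
qed

lemma J_cong_AE:
  assumes ae: "AE x in lborel. fst u x = fst v x \<and> snd u x = snd v x" and u: "u \<in> EE" and v: "v \<in> EE"
  shows "J lam1 lam2 mu1 mu2 \<beta> u = J lam1 lam2 mu1 mu2 \<beta> v"
proof -
  note [measurable] = EE_measurable[OF u] EE_measurable[OF v]
  have "normsq lam1 (fst u) = normsq lam1 (fst v)" "normsq lam2 (snd u) = normsq lam2 (snd v)"
    using ae u v by (auto intro!: normsq_cong_AE simp: EE_components)
  moreover have "F mu1 mu2 u = F mu1 mu2 v"
    unfolding F_def using ae by (intro arg_cong[where f = "\<lambda>z. 1/4 * z"] integral_cong_AE) auto
  moreover have "G u = G v"
    unfolding G_def using ae by (intro arg_cong[where f = "\<lambda>z. 1/2 * z"] integral_cong_AE) auto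
  ultimately show ?thesis by (simp add: J_def pair_norm_def)
qed

lemma W22_rad_invariant:
  fixes g :: "real^'n::finite \<Rightarrow> real^'n"
  assumes g: "orthogonal_transformation g" and u: "u \<in> W22_rad"
  shows "AE x in lborel. u (g x) = u x"
proof -
  obtain f where f: "AE x in lborel. u x = f (norm x)"
    using u by (auto simp: W22_rad_def)
  from AE_lborel_orthogonal[OF g f] f show ?thesis
    by eventually_elim (simp add: orthogonal_transformation_norm[OF g])
qed

text \<open>Because \<open>u\<close> is radial, \<open>u + t (h \<circ> g)\<close> is almost everywhere \<open>(u + t h) \<circ> g\<close>, where \<open>J\<close> has the same
  value as at \<open>u + t h\<close>. The two directional derivatives are therefore derivatives of one function
  of \<open>t\<close>.\<close>

lemma frechet_J_rotate:
  fixes g :: "real^'n::finite \<Rightarrow> real^'n"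
  assumes lam: "lam1 > 0" "lam2 > 0" and u: "u \<in> HH"
    and L: "has_frechet lam1 lam2 (J lam1 lam2 mu1 mu2 \<beta>) L u"
    and g: "orthogonal_transformation g" and h: "h \<in> EE"
  shows "L (rotate g h) = L h"
proof -
  have uE: "u \<in> EE" using u HH_subset_EE by blast
  have ae: "AE x in lborel. fst u (g x) = fst u x" "AE x in lborel. snd u (g x) = snd u x"
    using u by (auto simp: HH_def intro!: W22_rad_invariant[OF g])
  have "J lam1 lam2 mu1 mu2 \<beta> (u + scale t (rotate g h)) = J lam1 lam2 mu1 mu2 \<beta> (u + scale t h)" for t
  proof -
    have "J lam1 lam2 mu1 mu2 \<beta> (u + scale t (rotate g h)) = J lam1 lam2 mu1 mu2 \<beta> (rotate g (u + scale t h))"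
    proof (rule J_cong_AE)
      show "AE x in lborel. fst (u + scale t (rotate g h)) x = fst (rotate g (u + scale t h)) x \<and>
          snd (u + scale t (rotate g h)) x = snd (rotate g (u + scale t h)) x"
        using ae by eventually_elim (simp add: rotate_def scale_def)
    qed (intro EE_add EE_scale EE_rotate g h uE)+
    also have "\<dots> = J lam1 lam2 mu1 mu2 \<beta> (u + scale t h)"
      by (intro J_rotate g EE_add EE_scale h uE)
    finally show ?thesis .
  qed
  then show ?thesis
    using has_frechet_imp_directional[OF lam L EE_rotate[OF g h]]
      has_frechet_imp_directional[OF lam L h] by (simp add: DERIV_unique)
qed

lemma W22_zero: "(\<lambda>x. 0) \<in> W22"
proof (rule jet_W22)
  show "jet (\<lambda>x. 0) (\<lambda>i x. 0) (\<lambda>i j x. 0)" by (simp add: jet_def L2_zero weak_partial_def)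
qed

lemma W22_rad_zero: "(\<lambda>x. 0) \<in> W22_rad"
  unfolding W22_rad_def by (auto simp: W22_zero)

text \<open>Symmetric criticality is applied to the two components of a pair separately, that is, to the
  functionals \<open>v \<mapsto> L (v, 0)\<close> and \<open>v \<mapsto> L (0, v)\<close>. Both are instances of one argument about an
  embedding \<open>emb\<close> of single functions into pairs.\<close>

lemma frechet_J_vanishes_if_vanishes_on_HH:
  fixes u :: "'n::finite fpair"
  assumes dim: "CARD('n) \<ge> 2" and lam: "lam1 > 0" "lam2 > 0" and u: "u \<in> HH"
    and L: "has_frechet lam1 lam2 (J lam1 lam2 mu1 mu2 \<beta>) L u"
    and rad: "\<And>h. h \<in> HH \<Longrightarrow> L h = 0" and h: "h \<in> EE"
  shows "L h = 0"
proof -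
  have z: "(\<lambda>x::real^'n. 0) \<in> W22" by (rule W22_zero)
  have nz: "normsq lam (\<lambda>x::real^'n. 0) = 0" for lam
    using normsq_cmult[OF z, of lam 0] by simp
  have Ladd: "L (p + q) = L p + L q" if "p \<in> EE" "q \<in> EE" for p q
    using L that by (simp add: has_frechet_def)
  have Lscale: "L (scale c p) = c * L p" if "p \<in> EE" for p c
    using L that by (simp add: has_frechet_def)
  obtain C where C: "\<And>p. p \<in> EE \<Longrightarrow> \<bar>L p\<bar> \<le> C * pair_norm lam1 lam2 p"
    using L unfolding has_frechet_def by blast
  have vanish: "L (emb v) = 0"
    if emb: "\<And>v. v \<in> W22 \<Longrightarrow> emb v \<in> EE" "\<And>v. v \<in> W22_rad \<Longrightarrow> emb v \<in> HH"
      and emb_lin: "\<And>a b p q. emb (\<lambda>x. a * p x + b * q x) = scale a (emb p) + scale b (emb q)"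
      and emb_rot: "\<And>g p. emb (\<lambda>x. p (g x)) = rotate g (emb p)"
      and emb_norm: "\<And>p. (pair_norm lam1 lam2 (emb p))\<^sup>2 = normsq lam p"
      and "lam > 0" and v: "v \<in> W22"
    for emb :: "(real^'n \<Rightarrow> real) \<Rightarrow> 'n fpair" and v lam
  proof (rule symmetric_criticality[OF dim _ _ _ _ v])
    show "L (emb (\<lambda>x. a * p x + b * q x)) = a * L (emb p) + b * L (emb q)"
      if "p \<in> W22" "q \<in> W22" for p q a b
      using that by (simp add: emb_lin Ladd Lscale EE_scale emb)
    show "(L (emb p))\<^sup>2 \<le> C\<^sup>2 * (real CARD('n) + lam) * sobolev_sq p" if p: "p \<in> W22" for p
    proof -
      have "\<bar>L (emb p)\<bar>\<^sup>2 \<le> (C * pair_norm lam1 lam2 (emb p))\<^sup>2"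
        by (intro power_mono C emb p) simp
      also have "\<dots> = C\<^sup>2 * normsq lam p" by (simp add: power_mult_distrib emb_norm)
      also have "\<dots> \<le> C\<^sup>2 * ((real CARD('n) + lam) * sobolev_sq p)"
        using normsq_le_sobolev_sq[OF p, of lam] \<open>lam > 0\<close> by (intro mult_left_mono) auto
      finally show ?thesis by (simp add: mult.assoc)
    qed
    show "L (emb (\<lambda>x. p (g x))) = L (emb p)" if "orthogonal_transformation g" "p \<in> W22" for g p
      unfolding emb_rot by (rule frechet_J_rotate[OF lam u L that(1) emb(1)[OF that(2)]])
    show "L (emb p) = 0" if "p \<in> W22_rad" for p by (rule rad[OF emb(2)[OF that]])
  qed
  have hW: "fst h \<in> W22" "snd h \<in> W22" using h by (simp_all add: EE_components)
  have 1: "L (fst h, \<lambda>x. 0) = 0"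
    by (rule vanish[where emb = "\<lambda>v. (v, \<lambda>x. 0)" and lam = lam1])
      (use z W22_rad_zero hW lam in \<open>auto simp: EE_def HH_def scale_def rotate_def plus_fun_def pair_norm_sq[OF lam] nz\<close>)
  have 2: "L (\<lambda>x. 0, snd h) = 0"
    by (rule vanish[where emb = "\<lambda>v. (\<lambda>x. 0, v)" and lam = lam2])
      (use z W22_rad_zero hW lam in \<open>auto simp: EE_def HH_def scale_def rotate_def plus_fun_def pair_norm_sq[OF lam] nz\<close>)
  have "h = (fst h, \<lambda>x. 0) + (\<lambda>x. 0, snd h)"
    by (cases h) (simp add: plus_fun_def)
  then show ?thesis
    using Ladd[of "(fst h, \<lambda>x. 0)" "(\<lambda>x. 0, snd h)"] 1 2 hW z by (simp add: EE_def)
qed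

section \<open>Critical points and the Nehari manifold\<close>

lemma nontrivial_imp_pair_norm_pos:
  assumes lam: "lam1 > 0" "lam2 > 0" and u: "u \<in> EE" and nt: "nontrivial u"
  shows "pair_norm lam1 lam2 u \<noteq> 0"
proof
  assume "pair_norm lam1 lam2 u = 0"
  then have sum: "normsq lam1 (fst u) + normsq lam2 (snd u) = 0"
    using pair_norm_sq[OF lam, of u] by simp
  then have "normsq lam1 (fst u) = 0" "normsq lam2 (snd u) = 0"
    using normsq_nonneg[of lam1 "fst u"] normsq_nonneg[of lam2 "snd u"] lam by linarith+
  moreover have "AE x in lborel. v x = 0" if "normsq lam v = 0" "lam > 0" "v \<in> W22"
    for lam and v :: "real^'a \<Rightarrow> real"
  proof -
    have "0 \<le> (LINT x|lborel. (laplacian v x)\<^sup>2)" "0 \<le> lam * (LINT x|lborel. (v x)\<^sup>2)"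
      using that by simp_all
    then have "(LINT x|lborel. (v x)\<^sup>2) = 0"
      using that unfolding normsq_def by (smt (verit) mult_eq_0_iff)
    then have "AE x in lborel. (v x)\<^sup>2 = 0"
      using L2_integrable_square[OF W22_L2[OF that(3)]]
      by (subst (asm) integral_nonneg_eq_0_iff_AE) auto
    then show ?thesis by eventually_elim simp
  qed
  ultimately have "AE x in lborel. fst u x = 0" "AE x in lborel. snd u x = 0"
    using u lam by (simp_all add: EE_components)
  then have "AE x in lborel. fst u x = 0 \<and> snd u x = 0" by eventually_elim simp
  then show False using nt by (simp add: nontrivial_def)
qed

theorem proposition1p1:
  fixes u :: "(real^'n::finite \<Rightarrow> real) \<times> (real^'n \<Rightarrow> real)"
    and lam1 lam2 mu1 mu2 \<beta> :: real
  assumes "CARD('n) \<in> {2, 3}"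
    and "lam1 > 0" "lam2 > 0" "mu1 > 0" "mu2 > 0"
    and "u \<in> HH"
  shows "nontrivial u \<and> critical_point lam1 lam2 mu1 mu2 \<beta> u \<longleftrightarrow>
         u \<in> Nehari lam1 lam2 mu1 mu2 \<beta> \<and> constrained_critical_point lam1 lam2 mu1 mu2 \<beta> u"
proof -
  note lam = assms(2,3)
  have uE: "u \<in> EE" using assms(6) HH_subset_EE by blast
  have dim: "CARD('n) \<ge> 2" using assms(1) by auto
  show ?thesis
  proof
    assume *: "nontrivial u \<and> critical_point lam1 lam2 mu1 mu2 \<beta> u"
    then have J0: "has_frechet lam1 lam2 (J lam1 lam2 mu1 mu2 \<beta>) (\<lambda>h. 0) u"
      by (simp add: critical_point_def)
    have "Psi lam1 lam2 mu1 mu2 \<beta> u = 0"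
      by (rule DERIV_unique[OF scaling_derivatives(1)[OF lam uE] has_frechet_imp_directional[OF lam J0 uE]])
    then have N: "u \<in> Nehari lam1 lam2 mu1 mu2 \<beta>"
      using * assms(6) by (simp add: Nehari_def)
    have "\<forall>h\<in>HH. (0::real) = 0 * (4 * 0 - 2 * pair_form lam1 lam2 u h)" by simp
    then have "constrained_critical_point lam1 lam2 mu1 mu2 \<beta> u"
      unfolding constrained_critical_point_def using N J0 has_frechet_Psi[OF lam uE J0] by blast
    with N show "u \<in> Nehari lam1 lam2 mu1 mu2 \<beta> \<and> constrained_critical_point lam1 lam2 mu1 mu2 \<beta> u"
      by simp
  next
    assume *: "u \<in> Nehari lam1 lam2 mu1 mu2 \<beta> \<and> constrained_critical_point lam1 lam2 mu1 mu2 \<beta> u"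
    then have nt: "nontrivial u" and Psi0: "Psi lam1 lam2 mu1 mu2 \<beta> u = 0" by (simp_all add: Nehari_def)
    obtain L M \<omega> where L: "has_frechet lam1 lam2 (J lam1 lam2 mu1 mu2 \<beta>) L u"
      and M: "has_frechet lam1 lam2 (Psi lam1 lam2 mu1 mu2 \<beta>) M u"
      and LM: "\<And>h. h \<in> HH \<Longrightarrow> L h = \<omega> * M h"
      using * by (auto simp: constrained_critical_point_def)
    have "L u = 0"
      using DERIV_unique[OF has_frechet_imp_directional[OF lam L uE] scaling_derivatives(1)[OF lam uE]] Psi0
      by simp
    moreover have "M u = - 2 * (pair_norm lam1 lam2 u)\<^sup>2"
      using DERIV_unique[OF has_frechet_imp_directional[OF lam M uE] scaling_derivatives(2)[OF lam uE]] Psi0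
      by simp
    ultimately have "\<omega> = 0"
      using LM[OF assms(6)] nontrivial_imp_pair_norm_pos[OF lam uE nt] by simp
    then have "L h = 0" if "h \<in> EE" for h
      using frechet_J_vanishes_if_vanishes_on_HH[OF dim lam assms(6) L _ that] LM by simp
    then have "has_frechet lam1 lam2 (J lam1 lam2 mu1 mu2 \<beta>) (\<lambda>h. 0) u"
      using L by (simp add: has_frechet_def)
    with nt uE show "nontrivial u \<and> critical_point lam1 lam2 mu1 mu2 \<beta> u"
      by (simp add: critical_point_def)
  qed
qed

end
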